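(* Let $M$ be a von Neumann algebra and let $T: M\to M$ be a weak$^*$-local derivation, that is, a linear map (not assumed continuous) such that for every $a\in M$ and every normal state $\phi\in S_n(M)$ there exists a derivation $D_{a,\phi}: M\to M$, depending on $a$ and $\phi$, with $\phi(T(a)) = \phi(D_{a,\phi}(a))$. Then $T$ is a derivation.
   Context: A derivation on an algebra $M$ is a linear map $D:M\to M$ with $D(ab)=D(a)b+aD(b)$ for all $a,b\in M$. For a von Neumann algebra $M$ with predual $M_*$, $S_n(M)$ denotes the set of normal states of $M$, i.e. all norm-one positive functionals in $M_*$. *)

theory Defs
  imports "HOL-Analysis.Analysis"
begin

text \<open>Complex Hilbert spaces. The inner product is linear in the first argument. Positivity and
  definiteness of the inner product are contained in the last axiom, because the norm is a
  norm; completeness comes from the class \<^class>\<open>banach\<close>.\<close>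

class complex_hilbert_space = banach +
  fixes scaleC :: "complex \<Rightarrow> 'a \<Rightarrow> 'a"  (infixr "*\<^sub>C" 75)
    and cinner :: "'a \<Rightarrow> 'a \<Rightarrow> complex"
  assumes scaleC_add_right: "scaleC c (x + y) = scaleC c x + scaleC c y"
    and scaleC_add_left: "scaleC (c + d) x = scaleC c x + scaleC d x"
    and scaleC_scaleC: "scaleC c (scaleC d x) = scaleC (c * d) x"
    and scaleR_scaleC: "scaleR r x = scaleC (complex_of_real r) x"
    and cinner_commute: "cinner x y = cnj (cinner y x)"
    and cinner_add_left: "cinner (x + y) z = cinner x z + cinner y z"
    and cinner_scaleC_left: "cinner (scaleC c x) y = c * cinner x y"
    and cinner_self: "cinner x x = complex_of_real ((norm x)\<^sup>2)"

instantiation complex :: complex_hilbert_space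
begin

definition scaleC_complex :: "complex \<Rightarrow> complex \<Rightarrow> complex"
  where "scaleC_complex c x = c * x"

definition cinner_complex :: "complex \<Rightarrow> complex \<Rightarrow> complex"
  where "cinner_complex x y = x * cnj y"

instance
proof
  fix c d x y z :: complex and r :: real
  show "c *\<^sub>C (x + y) = c *\<^sub>C x + c *\<^sub>C y" "(c + d) *\<^sub>C x = c *\<^sub>C x + d *\<^sub>C x"
    "c *\<^sub>C d *\<^sub>C x = (c * d) *\<^sub>C x"
    by (simp_all add: scaleC_complex_def algebra_simps)
  show "r *\<^sub>R x = complex_of_real r *\<^sub>C x"
    by (simp add: scaleC_complex_def scaleR_conv_of_real)
  show "cinner x y = cnj (cinner y x)" "cinner (x + y) z = cinner x z + cinner y z"
    "cinner (c *\<^sub>C x) y = c * cinner x y"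
    by (simp_all add: scaleC_complex_def cinner_complex_def algebra_simps)
  show "cinner x x = complex_of_real ((norm x)\<^sup>2)"
    unfolding cinner_complex_def by (rule complex_norm_square [symmetric])
qed

end

lemma cinner_scaleC_right: "cinner x (c *\<^sub>C y) = cnj c * cinner x y"
proof -
  have "cinner x (c *\<^sub>C y) = cnj (cinner (c *\<^sub>C y) x)"
    by (rule cinner_commute)
  also have "\<dots> = cnj c * cnj (cinner y x)"
    by (simp add: cinner_scaleC_left)
  also have "cnj (cinner y x) = cinner x y"
    by (rule cinner_commute [symmetric])
  finally show ?thesis .
qed

lemma norm_scaleC: "norm (c *\<^sub>C x) = cmod c * norm (x :: 'h :: complex_hilbert_space)"
proof -
  have "complex_of_real ((norm (c *\<^sub>C x))\<^sup>2) = (c * cnj c) * complex_of_real ((norm x)\<^sup>2)"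
    by (simp only: cinner_self [symmetric] cinner_scaleC_left cinner_scaleC_right mult_ac)
  also have "\<dots> = complex_of_real ((cmod c * norm x)\<^sup>2)"
    by (simp add: complex_norm_square [symmetric] power_mult_distrib)
  finally have "(norm (c *\<^sub>C x))\<^sup>2 = (cmod c * norm x)\<^sup>2"
    using of_real_eq_iff by blast
  then show ?thesis
    by simp
qed

lemma bounded_linear_scaleC:
  "bounded_linear (\<lambda>x :: 'h :: complex_hilbert_space. c *\<^sub>C x)"
  by (rule bounded_linear_intro [where K = "cmod c"])
    (simp_all add: scaleC_add_right scaleR_scaleC scaleC_scaleC mult.commute norm_scaleC)


text \<open>The type \<^typ>\<open>'h \<Rightarrow>\<^sub>L 'h\<close> consists of the bounded real-linear operators; the following set
  is the algebra of bounded complex-linear operators on the Hilbert space. Sum, norm and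
  composition are those of \<^typ>\<open>'h \<Rightarrow>\<^sub>L 'h\<close>.\<close>

definition bounded_operators :: "('h :: complex_hilbert_space \<Rightarrow>\<^sub>L 'h) set" where
  "bounded_operators = {a. \<forall>c x. blinfun_apply a (c *\<^sub>C x) = c *\<^sub>C blinfun_apply a x}"

definition scaleC_op :: "complex \<Rightarrow> ('h :: complex_hilbert_space \<Rightarrow>\<^sub>L 'h) \<Rightarrow> ('h \<Rightarrow>\<^sub>L 'h)" where
  "scaleC_op c a = Blinfun (\<lambda>x. c *\<^sub>C blinfun_apply a x)"

lemma blinfun_apply_scaleC_op [simp]:
  "blinfun_apply (scaleC_op c a) x = c *\<^sub>C blinfun_apply a x"
  unfolding scaleC_op_def
  by (subst bounded_linear_Blinfun_apply)
    (auto intro: bounded_linear_compose [OF bounded_linear_scaleC] blinfun.bounded_linear_right)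

definition is_adjoint ::
    "('h :: complex_hilbert_space \<Rightarrow>\<^sub>L 'h) \<Rightarrow> ('h \<Rightarrow>\<^sub>L 'h) \<Rightarrow> bool" where
  "is_adjoint a b \<longleftrightarrow>
     (\<forall>x y. cinner (blinfun_apply a x) y = cinner x (blinfun_apply b y))"

lemma is_adjoint_unique:
  assumes "is_adjoint a b" "is_adjoint a c"
  shows "b = c"
proof (rule blinfun_eqI)
  fix y
  let ?z = "blinfun_apply b y - blinfun_apply c y"
  have "cinner ?z (blinfun_apply b y) = cinner (blinfun_apply a ?z) y"
    using assms(1) unfolding is_adjoint_def by simp
  also have "\<dots> = cinner ?z (blinfun_apply c y)"
    using assms(2) unfolding is_adjoint_def by simp
  finally have "cinner (blinfun_apply b y) ?z = cinner (blinfun_apply c y) ?z"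
    by (subst (1 2) cinner_commute) simp
  moreover have "cinner (blinfun_apply b y) ?z = cinner ?z ?z + cinner (blinfun_apply c y) ?z"
    by (simp flip: cinner_add_left)
  ultimately have "cinner ?z ?z = 0"
    by simp
  then show "blinfun_apply b y = blinfun_apply c y"
    by (simp add: cinner_self)
qed

definition commutant ::
    "('h :: complex_hilbert_space \<Rightarrow>\<^sub>L 'h) set \<Rightarrow> ('h \<Rightarrow>\<^sub>L 'h) set" where
  "commutant S = {b \<in> bounded_operators. \<forall>a \<in> S. a o\<^sub>L b = b o\<^sub>L a}"

text \<open>A von Neumann algebra is a self-adjoint set of bounded operators that equals its bicommutant
  (Dixmier's definition). It is then automatically a unital complex subalgebra, see below.\<close>

definition von_neumann_algebra :: "('h :: complex_hilbert_space \<Rightarrow>\<^sub>L 'h) set \<Rightarrow> bool" where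
  "von_neumann_algebra M \<longleftrightarrow>
     M \<subseteq> bounded_operators \<and>
     (\<forall>a \<in> M. \<exists>b \<in> M. is_adjoint a b) \<and>
     commutant (commutant M) = M"

lemma commutant_subalgebra:
  shows "id_blinfun \<in> commutant S"
    and "a \<in> commutant S \<Longrightarrow> b \<in> commutant S \<Longrightarrow> a + b \<in> commutant S"
    and "a \<in> commutant S \<Longrightarrow> b \<in> commutant S \<Longrightarrow> a o\<^sub>L b \<in> commutant S"
    and "S \<subseteq> bounded_operators \<Longrightarrow> a \<in> commutant S \<Longrightarrow> scaleC_op c a \<in> commutant S"
proof -
  have mem: "b \<in> commutant S \<longleftrightarrow>
      (\<forall>c x. blinfun_apply b (c *\<^sub>C x) = c *\<^sub>C blinfun_apply b x) \<and>
      (\<forall>a \<in> S. \<forall>x. blinfun_apply a (blinfun_apply b x) = blinfun_apply b (blinfun_apply a x))" for b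
    by (auto simp: commutant_def bounded_operators_def intro!: blinfun_eqI
        dest: arg_cong [where f = blinfun_apply] fun_cong)
      (metis blinfun_apply_blinfun_compose)
  show "id_blinfun \<in> commutant S"
    by (simp add: mem)
  show "a + b \<in> commutant S" if "a \<in> commutant S" "b \<in> commutant S"
    using that by (simp add: mem blinfun.add_left blinfun.add_right scaleC_add_right)
  show "a o\<^sub>L b \<in> commutant S" if "a \<in> commutant S" "b \<in> commutant S"
    using that by (simp add: mem)
  show "scaleC_op c a \<in> commutant S" if "S \<subseteq> bounded_operators" "a \<in> commutant S"
    using that by (auto simp: mem bounded_operators_def scaleC_scaleC mult.commute)
qed

lemma von_neumann_algebra_subalgebra:
  assumes "von_neumann_algebra M"
  shows "id_blinfun \<in> M"
    and "a \<in> M \<Longrightarrow> b \<in> M \<Longrightarrow> a + b \<in> M"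
    and "a \<in> M \<Longrightarrow> b \<in> M \<Longrightarrow> a o\<^sub>L b \<in> M"
    and "a \<in> M \<Longrightarrow> scaleC_op c a \<in> M"
proof -
  have M: "M = commutant (commutant M)"
    using assms by (simp add: von_neumann_algebra_def)
  have sub: "commutant M \<subseteq> bounded_operators"
    by (auto simp: commutant_def)
  show "id_blinfun \<in> M"
    and "a \<in> M \<Longrightarrow> b \<in> M \<Longrightarrow> a + b \<in> M"
    and "a \<in> M \<Longrightarrow> b \<in> M \<Longrightarrow> a o\<^sub>L b \<in> M"
    and "a \<in> M \<Longrightarrow> scaleC_op c a \<in> M"
    using commutant_subalgebra [where S = "commutant M"] sub by (simp_all flip: M)
qed


text \<open>In the following, functions on the algebra \<open>M\<close> are modelled by functions on the whole type
  \<^typ>\<open>'h \<Rightarrow>\<^sub>L 'h\<close>, of which only the values on \<open>M\<close> matter.\<close>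

text \<open>The predual of \<open>M\<close>: the ultraweakly continuous linear functionals on \<open>M\<close>, i.e. the
  restrictions to \<open>M\<close> of the functionals \<open>a \<mapsto> (\<Sum>n. \<langle>a \<xi>\<^sub>n, \<eta>\<^sub>n\<rangle>)\<close> that define the ultraweak
  topology.\<close>

definition predual ::
    "('h :: complex_hilbert_space \<Rightarrow>\<^sub>L 'h) set \<Rightarrow> (('h \<Rightarrow>\<^sub>L 'h) \<Rightarrow> complex) set" where
  "predual M =
     {\<phi>. \<exists>\<xi> \<eta> :: nat \<Rightarrow> 'h.
        summable (\<lambda>n. (norm (\<xi> n))\<^sup>2) \<and> summable (\<lambda>n. (norm (\<eta> n))\<^sup>2) \<and>
        (\<forall>a \<in> M. (\<lambda>n. cinner (blinfun_apply a (\<xi> n)) (\<eta> n)) sums \<phi> a)}"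

text \<open>Positivity is tested on the elements \<open>a\<^sup>* a\<close> with \<open>a \<in> M\<close>.\<close>

definition positive_functional ::
    "('h :: complex_hilbert_space \<Rightarrow>\<^sub>L 'h) set \<Rightarrow> (('h \<Rightarrow>\<^sub>L 'h) \<Rightarrow> complex) \<Rightarrow> bool" where
  "positive_functional M \<phi> \<longleftrightarrow>
     (\<forall>a \<in> M. \<forall>b \<in> M. is_adjoint a b \<longrightarrow> \<phi> (b o\<^sub>L a) \<in> \<real> \<and> 0 \<le> Re (\<phi> (b o\<^sub>L a)))"

definition functional_norm ::
    "('h :: complex_hilbert_space \<Rightarrow>\<^sub>L 'h) set \<Rightarrow> (('h \<Rightarrow>\<^sub>L 'h) \<Rightarrow> complex) \<Rightarrow> real" where
  "functional_norm M \<phi> = (SUP a \<in> {a \<in> M. norm a \<le> 1}. cmod (\<phi> a))"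

definition normal_states ::
    "('h :: complex_hilbert_space \<Rightarrow>\<^sub>L 'h) set \<Rightarrow> (('h \<Rightarrow>\<^sub>L 'h) \<Rightarrow> complex) set" where
  "normal_states M = {\<phi> \<in> predual M. positive_functional M \<phi> \<and> functional_norm M \<phi> = 1}"

definition linear_map_on ::
    "('h :: complex_hilbert_space \<Rightarrow>\<^sub>L 'h) set \<Rightarrow> (('h \<Rightarrow>\<^sub>L 'h) \<Rightarrow> ('h \<Rightarrow>\<^sub>L 'h)) \<Rightarrow> bool" where
  "linear_map_on M T \<longleftrightarrow>
     (\<forall>a \<in> M. T a \<in> M) \<and>
     (\<forall>a \<in> M. \<forall>b \<in> M. T (a + b) = T a + T b) \<and>
     (\<forall>c. \<forall>a \<in> M. T (scaleC_op c a) = scaleC_op c (T a))"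

definition derivation_on ::
    "('h :: complex_hilbert_space \<Rightarrow>\<^sub>L 'h) set \<Rightarrow> (('h \<Rightarrow>\<^sub>L 'h) \<Rightarrow> ('h \<Rightarrow>\<^sub>L 'h)) \<Rightarrow> bool" where
  "derivation_on M D \<longleftrightarrow>
     linear_map_on M D \<and>
     (\<forall>a \<in> M. \<forall>b \<in> M. D (a o\<^sub>L b) = (D a o\<^sub>L b) + (a o\<^sub>L D b))"

definition weak_star_local_derivation_on ::
    "('h :: complex_hilbert_space \<Rightarrow>\<^sub>L 'h) set \<Rightarrow> (('h \<Rightarrow>\<^sub>L 'h) \<Rightarrow> ('h \<Rightarrow>\<^sub>L 'h)) \<Rightarrow> bool" where
  "weak_star_local_derivation_on M T \<longleftrightarrow>
     linear_map_on M T \<and>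
     (\<forall>a \<in> M. \<forall>\<phi> \<in> normal_states M. \<exists>D. derivation_on M D \<and> \<phi> (T a) = \<phi> (D a))"

end

theory Submission
  imports Defs
begin

text \<open>For a derivation \<open>D\<close> and a projection \<open>p\<close> with \<open>x p = p x = 0\<close> one has \<open>p D(x) p = - p x D(p) = 0\<close>.
  Tested with vector states, this gives \<open>p T(x) p = 0\<close> for the given map \<open>T\<close>. Hence \<open>e T(x) e\<close> depends
  only on the corner \<open>e x e\<close> if \<open>e\<close> is a spectral projection of \<open>x\<close>.

  Let \<open>a\<close> be self-adjoint. Instead of continuity of \<open>T\<close>, a gliding hump argument is used: for orthogonal
  spectral projections \<open>h\<^sub>k\<close> of \<open>a\<close> belonging to short intervals around \<open>\<lambda>\<^sub>k\<close>, the single element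
  \<open>x = \<Sum> c\<^sub>k h\<^sub>k (a - \<lambda>\<^sub>k)\<close> still exists for large \<open>c\<^sub>k\<close>, and the compression of a suitable expression in
  \<open>T(x)\<close> by \<open>h\<^sub>k\<close> is a large multiple of the same expression for \<open>a\<close>. This first shows
  \<open>e T(e a) f = a e T(e) f\<close> for orthogonal projections \<open>e, f\<close> commuting with \<open>a\<close>, so that
  \<open>y = T(a\<^sup>2) - a T(a) - T(a) a\<close> commutes with the spectral projections of \<open>a\<close>, and then \<open>y = 0\<close>.
  So \<open>T\<close> is a Jordan derivation, and by Bresar's theorem it is a derivation, since a von Neumann
  algebra is semiprime.\<close>

section \<open>Complex Hilbert spaces\<close>

text \<open>The obstacle is that \<open>T\<close> is not known to be continuous, so what holds for
  combinations of spectral projections does not pass to limits. The hump rests on two rates: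
  bisection down to intervals of length of order 2^-n keeps at least the fraction 2^-n of the
  squared norm of a vector \<open>v\<close>. A multiplier of almost 2^n therefore leaves the block
  of \<open>a\<close> small, while it enlarges the block of \<open>v\<close> to almost 2^(n/2). An
  operator built from the single element \<open>x\<close> bounds all these products at once, so
  \<open>v\<close> must vanish. A vector with a component in an eigenspace escapes this argument;
  there \<open>a\<close> is a scalar, and homogeneity of \<open>T\<close> is enough.

  The hump for the off-diagonal rule is carried out with \<open>a\<close> on the left only. The rule
  with \<open>a\<close> on the right comes from the map sending x to the adjoint of T x, which has
  the same locality on self-adjoint elements. Together the two rules make the off-diagonal part of
  \<open>T\<close> a commutator, which is already a derivation and drops out of
  \<open>y\<close>.\<close>

lemma cinner_add_right: "cinner x (y + z) = cinner x y + cinner x (z :: 'h :: complex_hilbert_space)"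
  by (metis cinner_add_left cinner_commute complex_cnj_add)

lemma scaleC_minus1: "(-1) *\<^sub>C x = - (x :: 'h :: complex_hilbert_space)"
  using scaleR_scaleC [of "-1" x] by simp

lemma cinner_minus_left: "cinner (- x) y = - cinner x (y :: 'h :: complex_hilbert_space)"
  by (metis cinner_scaleC_left scaleC_minus1 mult_minus1)

lemma cinner_minus_right: "cinner x (- y) = - cinner x (y :: 'h :: complex_hilbert_space)"
  by (metis cinner_commute cinner_minus_left complex_cnj_minus)

lemma cinner_diff_left: "cinner (x - y) z = cinner x z - cinner y (z :: 'h :: complex_hilbert_space)"
  using cinner_add_left [of x "- y" z] by (simp add: cinner_minus_left)

lemma cinner_diff_right: "cinner x (y - z) = cinner x y - cinner x (z :: 'h :: complex_hilbert_space)"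
  using cinner_add_right [of x y "- z"] by (simp add: cinner_minus_right)

lemma cinner_zero [simp]: "cinner 0 x = 0" "cinner x (0 :: 'h :: complex_hilbert_space) = 0"
  using cinner_diff_left [of x x x] cinner_diff_right [of x x x] cinner_diff_left [of 0 0 x]
    cinner_diff_right [of x 0 0] by simp_all

lemma cinner_scaleR_left: "cinner (r *\<^sub>R x) y = of_real r * cinner x (y :: 'h :: complex_hilbert_space)"
  by (simp add: scaleR_scaleC cinner_scaleC_left)

lemma cinner_scaleR_right: "cinner x (r *\<^sub>R y) = of_real r * cinner x (y :: 'h :: complex_hilbert_space)"
  by (simp add: scaleR_scaleC cinner_scaleC_right)

lemmas cinner_simps = cinner_add_left cinner_add_right cinner_diff_left cinner_diff_right
  cinner_minus_left cinner_minus_right cinner_scaleR_left cinner_scaleR_right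
  cinner_scaleC_left cinner_scaleC_right

lemma norm_sq_eq_cinner: "(norm x)\<^sup>2 = Re (cinner x (x :: 'h :: complex_hilbert_space))"
  by (simp add: cinner_self)

lemma cinner_self_eq_0: "cinner x x = 0 \<longleftrightarrow> x = (0 :: 'h :: complex_hilbert_space)"
  by (simp add: cinner_self)

lemma Re_cinner_commute: "Re (cinner x y) = Re (cinner y (x :: 'h :: complex_hilbert_space))"
  by (subst cinner_commute) simp

lemma norm_add_sq: "(norm (x + y))\<^sup>2 = (norm x)\<^sup>2 + 2 * Re (cinner x y) + (norm (y :: 'h :: complex_hilbert_space))\<^sup>2"
  by (simp add: norm_sq_eq_cinner cinner_simps Re_cinner_commute [of y x])

lemma norm_diff_sq: "(norm (x - y))\<^sup>2 = (norm x)\<^sup>2 - 2 * Re (cinner x y) + (norm (y :: 'h :: complex_hilbert_space))\<^sup>2"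
  by (simp add: norm_sq_eq_cinner cinner_simps Re_cinner_commute [of y x])

text \<open>The triangle inequality belongs to the class, so Cauchy-Schwarz is read off from its
  square.\<close>

lemma Re_cinner_le: "Re (cinner x y) \<le> norm x * norm (y :: 'h :: complex_hilbert_space)"
proof -
  have "(norm (x + y))\<^sup>2 \<le> (norm x + norm y)\<^sup>2"
    by (simp add: norm_triangle_ineq power_mono)
  then show ?thesis
    by (simp add: norm_add_sq power2_sum)
qed

lemma norm_cinner_le: "cmod (cinner x y) \<le> norm x * norm (y :: 'h :: complex_hilbert_space)"
proof (cases "cinner x y = 0")
  case False
  \<comment> \<open>The unimodular factor \<open>u\<close> rotates the inner product onto its
    modulus, so the bound for real parts gives the full one.\<close>
  define u where "u = cnj (cinner x y) / cmod (cinner x y)"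
  have "cmod u = 1"
    using False by (simp add: u_def norm_divide)
  have "cinner (u *\<^sub>C x) y = of_real (cmod (cinner x y))"
    using False by (simp add: u_def cinner_scaleC_left complex_norm_square [symmetric] power2_eq_square mult.commute)
  then have "cmod (cinner x y) = Re (cinner (u *\<^sub>C x) y)"
    by simp
  also have "\<dots> \<le> norm (u *\<^sub>C x) * norm y"
    by (rule Re_cinner_le)
  finally show ?thesis
    using \<open>cmod u = 1\<close> by (simp add: norm_scaleC)
qed simp

lemma bounded_linear_cinner_left: "bounded_linear (\<lambda>x. cinner x (y :: 'h :: complex_hilbert_space))"
  by (rule bounded_linear_intro [where K = "norm y"])
    (auto simp: cinner_simps scaleR_conv_of_real norm_cinner_le)

lemma bounded_linear_cinner_right: "bounded_linear (\<lambda>y. cinner (x :: 'h :: complex_hilbert_space) y)"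
  by (rule bounded_linear_intro [where K = "norm x"])
    (auto simp: cinner_simps scaleR_conv_of_real norm_cinner_le mult.commute [of "norm _" "norm x"])

lemma scaleC_zero [simp]: "c *\<^sub>C (0 :: 'h :: complex_hilbert_space) = 0"
  using norm_scaleC [of c "0 :: 'h"] by auto

text \<open>If \<open>d\<close> is the distance from \<open>x\<close> to \<open>N\<close>, the parallelogram law bounds
  \<open>\<parallel>u - v\<parallel>\<^sup>2\<close> by \<open>2\<parallel>x - u\<parallel>\<^sup>2 + 2\<parallel>x - v\<parallel>\<^sup>2 - 4d\<^sup>2\<close>, so minimizing sequences are Cauchy.\<close>

lemma orthogonal_decomposition:
  fixes N :: "'h :: complex_hilbert_space set"
  assumes "closed N" "0 \<in> N" and add: "\<And>x y. x \<in> N \<Longrightarrow> y \<in> N \<Longrightarrow> x + y \<in> N"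
    and scale: "\<And>c x. x \<in> N \<Longrightarrow> c *\<^sub>C x \<in> N"
  obtains u where "u \<in> N" "\<And>y. y \<in> N \<Longrightarrow> cinner (x - u) y = 0"
proof -
  define d where "d = infdist x N"
  have Nne: "N \<noteq> {}" using assms by auto
  have d_le: "d \<le> norm (x - u)" if "u \<in> N" for u
    using infdist_le [OF that, of x] by (simp add: d_def dist_norm)
  have d0: "d \<ge> 0" by (simp add: d_def infdist_nonneg)
  have "\<exists>u\<in>N. norm (x - u) < d + 1 / real (Suc n)" for n
  proof (rule ccontr)
    assume "\<not> ?thesis"
    then have "d + 1 / real (Suc n) \<le> infdist x N"
      unfolding infdist_notempty [OF Nne] by (intro cINF_greatest Nne) (auto simp: dist_norm not_less)
    then have "d + 1 / real (Suc n) \<le> d" by (simp only: d_def)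
    then show False by (simp add: field_simps)
  qed
  then obtain u where u: "\<And>n. u n \<in> N" "\<And>n. norm (x - u n) < d + 1 / real (Suc n)"
    by metis
  have half: "(1/2) *\<^sub>R (v + w) \<in> N" if "v \<in> N" "w \<in> N" for v w
    using that add scale by (simp add: scaleR_scaleC)
  have par: "(norm (v - w))\<^sup>2 \<le> 2 * (norm (x - v))\<^sup>2 + 2 * (norm (x - w))\<^sup>2 - 4 * d\<^sup>2"
    if "v \<in> N" "w \<in> N" for v w
  proof -
    have "d\<^sup>2 \<le> (norm (x - (1/2) *\<^sub>R (v + w)))\<^sup>2"
      using d_le [OF half [OF that]] d0 by (rule power_mono)
    then show ?thesis
      by (simp add: norm_sq_eq_cinner cinner_simps Re_cinner_commute [of w v]
          Re_cinner_commute [of v x] Re_cinner_commute [of w x] field_simps)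
  qed
  have "(\<lambda>n. (d + 1 / real (Suc n))\<^sup>2) \<longlonglongrightarrow> (d + 0)\<^sup>2"
    using LIMSEQ_inverse_real_of_nat by (intro tendsto_intros) (simp add: inverse_eq_divide)
  then have lim: "(\<lambda>n. (d + 1 / real (Suc n))\<^sup>2) \<longlonglongrightarrow> d\<^sup>2" by simp
  have "Cauchy u"
    unfolding Cauchy_def
  proof (intro allI impI)
    fix e :: real assume "e > 0"
    then obtain K where K: "\<And>n. n \<ge> K \<Longrightarrow> (d + 1 / real (Suc n))\<^sup>2 < d\<^sup>2 + e\<^sup>2 / 4"
      using order_tendstoD(2) [OF lim, of "d\<^sup>2 + e\<^sup>2 / 4"] by (auto simp: eventually_sequentially)
    have *: "(norm (x - u n))\<^sup>2 < d\<^sup>2 + e\<^sup>2 / 4" if "n \<ge> K" for n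
      using K [OF that] power_mono [OF less_imp_le [OF u(2) [of n]], of 2] by simp
    have "dist (u m) (u n) < e" if "m \<ge> K" "n \<ge> K" for m n
    proof -
      have "(norm (u m - u n))\<^sup>2 < e\<^sup>2"
        using par [OF u(1) u(1), of m n] * [OF that(1)] * [OF that(2)] by simp
      then show ?thesis
        using \<open>e > 0\<close> power2_less_imp_less [of "norm (u m - u n)" e] by (simp add: dist_norm)
    qed
    then show "\<exists>M. \<forall>m\<ge>M. \<forall>n\<ge>M. dist (u m) (u n) < e" by blast
  qed
  then obtain l where l: "u \<longlonglongrightarrow> l"
    using convergent_eq_Cauchy by blast
  have lN: "l \<in> N"
    using closed_sequentially [OF \<open>closed N\<close> _ l] u(1) by blast
  have "(\<lambda>n. (norm (x - u n))\<^sup>2) \<longlonglongrightarrow> (norm (x - l))\<^sup>2"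
    by (intro tendsto_intros l)
  then have "(norm (x - l))\<^sup>2 \<le> d\<^sup>2"
    by (rule LIMSEQ_le [OF _ lim]) (metis less_imp_le norm_ge_zero power_mono u(2))
  then have min: "(norm (x - l))\<^sup>2 \<le> (norm (x - l - y))\<^sup>2" if "y \<in> N" for y
    using power_mono [OF d_le [OF add [OF lN that]] d0, of 2] by (metis diff_diff_eq order_trans)
  have re: "Re (cinner (x - l) y) \<le> 0" if "y \<in> N" for y
  proof (rule ccontr)
    assume "\<not> ?thesis"
    then have pos: "Re (cinner (x - l) y) > 0" by simp
    then have "y \<noteq> 0" by auto
    \<comment> \<open>The minimizer of the quadratic polynomial norm (x - l - t y)^2 in t.\<close>
    define t where "t = Re (cinner (x - l) y) / (norm y)\<^sup>2"
    have "t > 0" using pos \<open>y \<noteq> 0\<close> by (simp add: t_def)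
    have "t *\<^sub>R y \<in> N" using scale that by (simp add: scaleR_scaleC)
    from min [OF this] have "0 \<le> - 2 * t * Re (cinner (x - l) y) + t\<^sup>2 * (norm y)\<^sup>2"
      by (simp add: norm_diff_sq cinner_scaleR_right power_mult_distrib)
    also have "\<dots> = - t * Re (cinner (x - l) y)"
      using \<open>y \<noteq> 0\<close> by (simp add: t_def power2_eq_square field_simps)
    finally show False using pos \<open>t > 0\<close> mult_pos_pos [of t "Re (cinner (x - l) y)"] by linarith
  qed
  \<comment> \<open>\<open>N\<close> is closed under complex scalars, so \<open>re\<close> applies
    to \<open>y\<close>, \<open>-y\<close>, \<open>\<i> y\<close> and \<open>-\<i> y\<close>, which
    settles the real and the imaginary part.\<close>
  have "cinner (x - l) y = 0" if "y \<in> N" for y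
  proof (rule complex_eqI)
    show "Re (cinner (x - l) y) = Re 0"
      using re [OF that] re [OF scale [OF that, of "-1"]] by (simp add: cinner_scaleC_right)
    show "Im (cinner (x - l) y) = Im 0"
      using re [OF scale [OF that, of "\<i>"]] re [OF scale [OF that, of "-\<i>"]]
      by (simp add: cinner_scaleC_right)
  qed
  then show thesis using that lN by blast
qed

section \<open>Self-adjoint operators and projections\<close>

text \<open>The infix \<open>o\<^sub>L\<close> of the library binds weaker than addition.\<close>

abbreviation op_mult :: "('h :: real_normed_vector \<Rightarrow>\<^sub>L 'h) \<Rightarrow> ('h \<Rightarrow>\<^sub>L 'h) \<Rightarrow> ('h \<Rightarrow>\<^sub>L 'h)"
  (infixl "\<odot>" 70) where "a \<odot> b \<equiv> a o\<^sub>L b"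

lemmas compose_add_left = bounded_bilinear.add_left [OF bounded_bilinear_blinfun_compose]
lemmas compose_add_right = bounded_bilinear.add_right [OF bounded_bilinear_blinfun_compose]
lemmas compose_diff_left = bounded_bilinear.diff_left [OF bounded_bilinear_blinfun_compose]
lemmas compose_diff_right = bounded_bilinear.diff_right [OF bounded_bilinear_blinfun_compose]
lemmas compose_minus_left = bounded_bilinear.minus_left [OF bounded_bilinear_blinfun_compose]
lemmas compose_minus_right = bounded_bilinear.minus_right [OF bounded_bilinear_blinfun_compose]
lemmas compose_scaleR_left = bounded_bilinear.scaleR_left [OF bounded_bilinear_blinfun_compose]
lemmas compose_scaleR_right = bounded_bilinear.scaleR_right [OF bounded_bilinear_blinfun_compose]

lemma compose_assoc: "(a \<odot> b) \<odot> c = a \<odot> (b \<odot> c)"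
  by (rule blinfun_eqI) simp

lemma compose_id [simp]: "id_blinfun \<odot> a = a" "a \<odot> id_blinfun = a"
  by (rule blinfun_eqI, simp)+

lemmas compose_simps = compose_add_left compose_add_right compose_diff_left compose_diff_right
  compose_minus_left compose_minus_right compose_scaleR_left compose_scaleR_right compose_assoc

lemmas blinfun_simps = blinfun.add_left blinfun.add_right blinfun.diff_left blinfun.diff_right
  blinfun.scaleR_left blinfun.scaleR_right blinfun.minus_left blinfun.minus_right
  blinfun.zero_left blinfun.zero_right

definition self_adjoint :: "('h :: complex_hilbert_space \<Rightarrow>\<^sub>L 'h) \<Rightarrow> bool"
  where "self_adjoint a \<longleftrightarrow> is_adjoint a a"

definition projection :: "('h :: complex_hilbert_space \<Rightarrow>\<^sub>L 'h) \<Rightarrow> bool"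
  where "projection p \<longleftrightarrow> self_adjoint p \<and> p \<odot> p = p"

lemma self_adjointD: "self_adjoint a \<Longrightarrow> cinner (blinfun_apply a x) y = cinner x (blinfun_apply a y)"
  by (simp add: self_adjoint_def is_adjoint_def)

lemma self_adjointI:
  "(\<And>x y. cinner (blinfun_apply a x) y = cinner x (blinfun_apply a y)) \<Longrightarrow> self_adjoint a"
  by (simp add: self_adjoint_def is_adjoint_def)

lemma self_adjoint_zero [simp]: "self_adjoint 0"
  and self_adjoint_id [simp]: "self_adjoint id_blinfun"
  by (rule self_adjointI, simp)+

lemma self_adjoint_add [simp]: "self_adjoint a \<Longrightarrow> self_adjoint b \<Longrightarrow> self_adjoint (a + b)"
  by (auto intro!: self_adjointI simp: blinfun_simps cinner_simps self_adjointD)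

lemma self_adjoint_diff [simp]: "self_adjoint a \<Longrightarrow> self_adjoint b \<Longrightarrow> self_adjoint (a - b)"
  by (auto intro!: self_adjointI simp: blinfun_simps cinner_simps self_adjointD)

lemma self_adjoint_scaleR [simp]: "self_adjoint a \<Longrightarrow> self_adjoint (r *\<^sub>R a)"
  by (auto intro!: self_adjointI simp: blinfun_simps cinner_simps self_adjointD)

lemma self_adjoint_compose:
  "self_adjoint a \<Longrightarrow> self_adjoint b \<Longrightarrow> a \<odot> b = b \<odot> a \<Longrightarrow> self_adjoint (a \<odot> b)"
  by (rule self_adjointI) (metis self_adjointD blinfun_apply_blinfun_compose)

lemma self_adjoint_square [simp]: "self_adjoint a \<Longrightarrow> self_adjoint (a \<odot> a)"
  by (simp add: self_adjoint_compose)

lemma tendsto_cinner_blinfun: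
  assumes "X \<longlonglongrightarrow> (a :: 'h :: complex_hilbert_space \<Rightarrow>\<^sub>L 'h)"
  shows "(\<lambda>n. cinner (blinfun_apply (X n) x) y) \<longlonglongrightarrow> cinner (blinfun_apply a x) y"
    and "(\<lambda>n. cinner y (blinfun_apply (X n) x)) \<longlonglongrightarrow> cinner y (blinfun_apply a x)"
  by (intro bounded_linear.tendsto [OF bounded_linear_cinner_left]
      bounded_linear.tendsto [OF bounded_linear_cinner_right]
      bounded_linear.tendsto [OF blinfun.bounded_linear_left] assms)+

lemma self_adjoint_limit:
  assumes "\<And>n. self_adjoint (X n)" "X \<longlonglongrightarrow> a"
  shows "self_adjoint a"
proof (rule self_adjointI)
  fix x y
  show "cinner (blinfun_apply a x) y = cinner x (blinfun_apply a y)"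
    using tendsto_cinner_blinfun(1) [OF assms(2), of x y]
      tendsto_cinner_blinfun(2) [OF assms(2), of x y] assms(1)
    by (simp add: self_adjointD LIMSEQ_unique)
qed

lemma projection_self_adjoint [simp]: "projection p \<Longrightarrow> self_adjoint p"
  and projection_idem [simp]: "projection p \<Longrightarrow> p \<odot> p = p"
  by (simp_all add: projection_def)

lemma projection_apply [simp]:
  "projection p \<Longrightarrow> blinfun_apply p (blinfun_apply p x) = blinfun_apply p x"
  by (metis projection_idem blinfun_apply_blinfun_compose)

lemma projection_idem_left: "projection p \<Longrightarrow> p \<odot> (p \<odot> x) = p \<odot> x"
  by (simp flip: compose_assoc)

lemma projection_id [simp]: "projection id_blinfun"
  by (simp add: projection_def)

lemma projection_complement [simp]: "projection p \<Longrightarrow> projection (id_blinfun - p)"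
  unfolding projection_def by (simp add: compose_simps)

lemma projection_compose:
  "projection p \<Longrightarrow> projection q \<Longrightarrow> p \<odot> q = q \<odot> p \<Longrightarrow> projection (p \<odot> q)"
  unfolding projection_def by (metis self_adjoint_compose compose_assoc)

lemma projection_norm_sq:
  "projection p \<Longrightarrow> (norm (blinfun_apply p x))\<^sup>2 = Re (cinner (blinfun_apply p x) x)"
  by (simp add: norm_sq_eq_cinner self_adjointD)

lemma projection_pythagoras:
  assumes "projection p"
  shows "(norm x)\<^sup>2 = (norm (blinfun_apply p x))\<^sup>2 + (norm (x - blinfun_apply p x))\<^sup>2"
  by (simp add: norm_diff_sq projection_norm_sq [OF assms] Re_cinner_commute [of x])

lemma projection_norm_le:
  assumes "projection p"
  shows "norm (blinfun_apply p x) \<le> norm x"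
proof (rule power2_le_imp_le)
  show "(norm (blinfun_apply p x))\<^sup>2 \<le> (norm x)\<^sup>2"
    using projection_pythagoras [OF assms, of x] by simp
qed simp

lemma norm_projection_compose_le:
  assumes "projection p"
  shows "norm (p \<odot> a) \<le> norm a"
proof (rule norm_blinfun_bound)
  show "norm (blinfun_apply (p \<odot> a) x) \<le> norm a * norm x" for x
    using projection_norm_le [OF assms, of "blinfun_apply a x"] norm_blinfun [of a x] by simp
qed simp

lemma norm_compose_projection_le:
  assumes "projection p"
  shows "norm (a \<odot> p) \<le> norm a"
proof (rule norm_blinfun_bound)
  show "norm (blinfun_apply (a \<odot> p) x) \<le> norm a * norm x" for x
    using norm_blinfun [of a "blinfun_apply p x"]
      mult_left_mono [OF projection_norm_le [OF assms, of x] norm_ge_zero [of a]] by simp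
qed simp

section \<open>Commutants, norm limits and kernel projections\<close>

lemma mem_commutant:
  "b \<in> commutant S \<longleftrightarrow>
      (\<forall>c x. blinfun_apply b (c *\<^sub>C x) = c *\<^sub>C blinfun_apply b x) \<and>
      (\<forall>a \<in> S. \<forall>x. blinfun_apply a (blinfun_apply b x) = blinfun_apply b (blinfun_apply a x))"
  by (auto simp: commutant_def bounded_operators_def intro!: blinfun_eqI
        dest: arg_cong [where f = blinfun_apply] fun_cong)
    (metis blinfun_apply_blinfun_compose)

lemma commutant_scaleR: "a \<in> commutant S \<Longrightarrow> r *\<^sub>R a \<in> commutant S"
  by (simp add: mem_commutant blinfun_simps scaleR_scaleC scaleC_scaleC mult.commute)
    (metis blinfun.scaleR_right scaleR_scaleC)

lemma commutant_diff: "a \<in> commutant S \<Longrightarrow> b \<in> commutant S \<Longrightarrow> a - b \<in> commutant S"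
  using commutant_subalgebra(2) [of a S "(-1) *\<^sub>R b"] commutant_scaleR [of b S "-1"] by simp

lemma commutant_zero [simp]: "0 \<in> commutant S"
  by (simp add: mem_commutant)

lemmas commutant_intros = commutant_scaleR commutant_diff commutant_subalgebra(1-3)

lemma commutant_limit:
  assumes X: "\<And>n. X n \<in> commutant S" and lim: "X \<longlonglongrightarrow> a"
  shows "a \<in> commutant S"
proof -
  have l: "(\<lambda>n. blinfun_apply (X n) x) \<longlonglongrightarrow> blinfun_apply a x" for x
    by (intro bounded_linear.tendsto [OF blinfun.bounded_linear_left] lim)
  have "blinfun_apply a (c *\<^sub>C x) = c *\<^sub>C blinfun_apply a x" for c x
    using X l [of "c *\<^sub>C x"] bounded_linear.tendsto [OF bounded_linear_scaleC l, of c x]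
    by (simp add: mem_commutant LIMSEQ_unique)
  moreover have "blinfun_apply b (blinfun_apply a x) = blinfun_apply a (blinfun_apply b x)"
    if "b \<in> S" for b x
    using X that l [of "blinfun_apply b x"]
      bounded_linear.tendsto [OF blinfun.bounded_linear_right l, of b x]
    by (simp add: mem_commutant LIMSEQ_unique)
  ultimately show ?thesis
    by (simp add: mem_commutant)
qed

text \<open>The kernel of a self-adjoint \<open>w\<close> is the orthogonal complement of its range,
  so \<open>f\<close> is the complement of the projection \<open>g\<close> onto the closed range.
  Elements of \<open>S\<close> commute with \<open>w\<close>, hence preserve both subspaces and
  commute with \<open>g\<close>.\<close>

lemma kernel_projection:
  fixes w :: "'h :: complex_hilbert_space \<Rightarrow>\<^sub>L 'h"
  assumes w: "w \<in> commutant S" and S: "S \<subseteq> bounded_operators" and sa: "self_adjoint w"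
  obtains f where "projection f" "f \<in> commutant S" "w \<odot> f = 0"
    "\<And>x. blinfun_apply w x = 0 \<Longrightarrow> blinfun_apply f x = x"
proof -
  define N where "N = closure (range (blinfun_apply w))"
  have wC: "blinfun_apply w (c *\<^sub>C x) = c *\<^sub>C blinfun_apply w x" for c x
    using w by (simp add: mem_commutant)
  have scale: "c *\<^sub>C x \<in> N" if "x \<in> N" for c x
  proof -
    have "(\<lambda>x. c *\<^sub>C x) ` closure (range (blinfun_apply w)) \<subseteq> N"
      unfolding N_def
      by (intro image_closure_subset linear_continuous_on bounded_linear_scaleC closed_closure)
        (auto simp flip: wC intro!: closure_subset [THEN subsetD])
    then show ?thesis using that by (auto simp: N_def)
  qed
  have "x + y \<in> N" if xy: "x \<in> N" "y \<in> N" for x y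
  proof -
    obtain X Y where XY: "\<And>n. X n \<in> range (blinfun_apply w)" "X \<longlonglongrightarrow> x"
      "\<And>n. Y n \<in> range (blinfun_apply w)" "Y \<longlonglongrightarrow> y"
      using xy unfolding N_def closure_sequential by blast
    have "X n + Y n \<in> range (blinfun_apply w)" for n
    proof -
      obtain a b where "X n = blinfun_apply w a" "Y n = blinfun_apply w b"
        using XY(1) [of n] XY(3) [of n] by blast
      then have "X n + Y n = blinfun_apply w (a + b)"
        by (simp add: blinfun.add_right)
      then show ?thesis by (simp only: rangeI)
    qed
    then show ?thesis
      unfolding N_def closure_sequential
      by (intro exI [of _ "\<lambda>n. X n + Y n"] conjI allI tendsto_add XY(2,4))
  qed
  moreover have "0 \<in> N"
    using subsetD [OF closure_subset rangeI [of "blinfun_apply w" 0]] by (simp add: N_def)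
  ultimately have subs: "subspace N"
    using scale by (intro subspaceI) (simp_all add: scaleR_scaleC)
  define P where "P x u \<longleftrightarrow> u \<in> N \<and> (\<forall>y\<in>N. cinner (x - u) y = 0)" for x u
  have ex: "\<exists>u. P x u" for x
  proof -
    obtain u where "u \<in> N" "\<And>y. y \<in> N \<Longrightarrow> cinner (x - u) y = 0"
      by (rule orthogonal_decomposition [of N x])
        (use subs scale in \<open>auto simp: N_def subspace_0 subspace_add\<close>)
    then show ?thesis by (auto simp: P_def)
  qed
  have unique: "u = v" if "P x u" "P x v" for x u v
  proof -
    have "u - v \<in> N" using that subs by (auto simp: P_def subspace_diff)
    then have "cinner (x - u) (u - v) = 0" "cinner (x - v) (u - v) = 0"
      using that by (auto simp: P_def)
    moreover have "cinner (u - v) (u - v) = cinner (x - v) (u - v) - cinner (x - u) (u - v)"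
      by (simp flip: cinner_diff_left)
    ultimately have "cinner (u - v) (u - v) = 0"
      by simp
    then show ?thesis by (simp add: cinner_self_eq_0)
  qed
  \<comment> \<open>\<open>G\<close> is picked by choice; uniqueness of the decomposition makes it
    additive, homogeneous and the identity on \<open>N\<close>.\<close>
  define G where "G x = (SOME u. P x u)" for x
  have PG: "P x (G x)" for x
    unfolding G_def using ex by (rule someI_ex)
  have GI: "P x u \<Longrightarrow> G x = u" for x u
    using unique PG by blast
  have Gadd: "G (x + y) = G x + G y" for x y
    using PG [of x] PG [of y] subs
    by (intro GI) (auto simp: P_def subspace_add cinner_simps algebra_simps)
  have GC: "G (c *\<^sub>C x) = c *\<^sub>C G x" for c x
    using PG [of x] scale by (intro GI) (auto simp: P_def cinner_simps)
  have GR: "G (r *\<^sub>R x) = r *\<^sub>R G x" for r x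
    using GC by (simp add: scaleR_scaleC)
  have Gnorm: "norm (G x) \<le> norm x" for x
  proof (rule power2_le_imp_le)
    have "cinner (x - G x) (G x) = 0"
      using PG by (simp add: P_def)
    then have "(norm x)\<^sup>2 = (norm (x - G x))\<^sup>2 + (norm (G x))\<^sup>2"
      using norm_add_sq [of "x - G x" "G x"] by simp
    then show "(norm (G x))\<^sup>2 \<le> (norm x)\<^sup>2" by simp
  qed simp
  have "bounded_linear G"
    by (rule bounded_linear_intro [where K = 1]) (simp_all add: Gadd GR Gnorm)
  define g where "g = Blinfun G"
  have g [simp]: "blinfun_apply g = G"
    unfolding g_def by (rule bounded_linear_Blinfun_apply) fact
  have GN: "G x \<in> N" for x
    using PG by (simp add: P_def)
  have orth: "cinner (x - G x) y = 0" if "y \<in> N" for x y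
    using PG that by (simp add: P_def)
  have GG: "G x = x" if "x \<in> N" for x
    using that by (intro GI) (simp add: P_def)
  have "projection g"
    unfolding projection_def
  proof
    show "self_adjoint g"
    proof (rule self_adjointI)
      fix x y
      have "cinner (x - G x) (G y) = 0" "cinner (y - G y) (G x) = 0"
        using orth GN by auto
      then have "cinner x (G y) = cinner (G x) (G y)" "cinner (G x) y = cinner (G x) (G y)"
        using cinner_commute [of "G x" "y - G y"] by (simp_all add: cinner_simps)
      then show "cinner (blinfun_apply g x) y = cinner x (blinfun_apply g y)"
        by simp
    qed
    show "g \<odot> g = g"
      by (rule blinfun_eqI) (simp add: GG GN)
  qed
  have rangeN: "blinfun_apply w z \<in> N" for z
    unfolding N_def by (rule subsetD [OF closure_subset rangeI])
  have wG: "blinfun_apply w (x - G x) = 0" for x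
  proof -
    have "cinner (blinfun_apply w (x - G x)) y = 0" for y
      using orth [OF rangeN] by (simp add: self_adjointD [OF sa])
    then show ?thesis by (metis cinner_self_eq_0)
  qed
  have G0: "G x = 0" if "blinfun_apply w x = 0" for x
  proof (rule GI)
    have "closed {y. cinner x y = 0}"
      by (intro closed_Collect_eq continuous_intros linear_continuous_on bounded_linear_cinner_right)
    moreover have "range (blinfun_apply w) \<subseteq> {y. cinner x y = 0}"
      using that by (auto simp flip: self_adjointD [OF sa])
    ultimately have "N \<subseteq> {y. cinner x y = 0}"
      unfolding N_def by (rule closure_minimal [rotated])
    then show "P x 0"
      using subs by (auto simp: P_def subspace_0)
  qed
  have comm: "blinfun_apply b (G x) = G (blinfun_apply b x)" if "b \<in> S" for b x
  proof -
    have bw: "blinfun_apply b (blinfun_apply w z) = blinfun_apply w (blinfun_apply b z)" for z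
      using w that by (simp add: mem_commutant)
    have "blinfun_apply b ` closure (range (blinfun_apply w)) \<subseteq> N"
      unfolding N_def
      by (intro image_closure_subset linear_continuous_on blinfun.bounded_linear_right closed_closure)
        (auto simp: bw intro!: closure_subset [THEN subsetD])
    then have "blinfun_apply b (G x) \<in> N"
      using GN by (auto simp: N_def)
    moreover have "G (blinfun_apply b (x - G x)) = 0"
      by (rule G0) (simp add: wG flip: bw)
    ultimately show ?thesis
      using Gadd [of "blinfun_apply b (G x)" "blinfun_apply b (x - G x)"]
      by (simp add: GG blinfun_simps)
  qed
  have "g \<in> commutant S"
    by (simp add: mem_commutant comm GC)
  show thesis
  proof
    show "projection (id_blinfun - g)"
      using \<open>projection g\<close> by simp
    show "id_blinfun - g \<in> commutant S"
      by (intro commutant_intros \<open>g \<in> commutant S\<close>)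
    show "w \<odot> (id_blinfun - g) = 0"
      by (rule blinfun_eqI) (simp add: wG blinfun.diff_left)
    show "blinfun_apply (id_blinfun - g) x = x" if "blinfun_apply w x = 0" for x
      using that by (simp add: G0 blinfun.diff_left)
  qed
qed

section \<open>Spectral bisection\<close>

text \<open>The iteration \<open>y\<^sub>n\<^sub>+\<^sub>1 = (c + y\<^sub>n\<^sup>2) / 2\<close> for the solution of \<open>(1 - y)\<^sup>2 = 1 - c\<close>.
  Its increments are dominated by those of the scalar iteration with \<open>c = 1\<close>.\<close>

primrec sqrt_iter :: "('h :: complex_hilbert_space \<Rightarrow>\<^sub>L 'h) \<Rightarrow> nat \<Rightarrow> ('h \<Rightarrow>\<^sub>L 'h)" where
  "sqrt_iter c 0 = 0"
| "sqrt_iter c (Suc n) = (1/2) *\<^sub>R (c + sqrt_iter c n \<odot> sqrt_iter c n)"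

primrec sqrt_bound :: "nat \<Rightarrow> real" where
  "sqrt_bound 0 = 0"
| "sqrt_bound (Suc n) = (1 + (sqrt_bound n)\<^sup>2) / 2"

lemma sqrt_bound_range: "0 \<le> sqrt_bound n \<and> sqrt_bound n \<le> 1"
proof (induction n)
  case (Suc n)
  then have "(sqrt_bound n)\<^sup>2 \<le> 1" by (simp add: power_le_one)
  then show ?case by simp
qed simp

lemma sqrt_iter_increment:
  fixes c :: "'h :: complex_hilbert_space \<Rightarrow>\<^sub>L 'h"
  assumes "norm c \<le> 1"
  shows "norm (sqrt_iter c n) \<le> sqrt_bound n \<and>
    norm (sqrt_iter c (Suc n) - sqrt_iter c n) \<le> sqrt_bound (Suc n) - sqrt_bound n"
proof (induction n)
  case 0
  then show ?case using assms by simp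
next
  case (Suc n)
  let ?y = "sqrt_iter c n" and ?z = "sqrt_iter c (Suc n)"
  let ?r = "sqrt_bound n" and ?s = "sqrt_bound (Suc n)"
  have z: "norm ?z \<le> ?s"
    using norm_triangle_ineq [of "?z - ?y" ?y] Suc by (simp del: sqrt_iter.simps sqrt_bound.simps)
  have rs: "?r \<le> ?s"
    using Suc norm_ge_zero [of "?z - ?y"] by linarith
  \<comment> \<open>The identity z z - y y = (z - y) z + y (z - y) needs no commutativity. With the
    scalar bounds in place of the norms, the resulting estimate is an equality for
    \<open>sqrt_bound\<close>.\<close>
  have "sqrt_iter c (Suc (Suc n)) - ?z = (1/2) *\<^sub>R ((?z - ?y) \<odot> ?z + ?y \<odot> (?z - ?y))"
    by (simp only: sqrt_iter.simps(2) [of c "Suc n"])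
      (subst (3) sqrt_iter.simps(2), simp only: compose_diff_left compose_diff_right scaleR_diff_right
          scaleR_add_right, simp)
  then have "norm (sqrt_iter c (Suc (Suc n)) - ?z) =
      norm ((?z - ?y) \<odot> ?z + ?y \<odot> (?z - ?y)) / 2"
    by simp
  also have "norm ((?z - ?y) \<odot> ?z + ?y \<odot> (?z - ?y)) \<le>
      norm (?z - ?y) * norm ?z + norm ?y * norm (?z - ?y)"
    by (intro norm_triangle_le add_mono norm_blinfun_compose)
  also have "\<dots> \<le> (?s - ?r) * ?s + ?r * (?s - ?r)"
    using Suc z rs sqrt_bound_range
    by (intro add_mono mult_mono) (simp_all del: sqrt_iter.simps sqrt_bound.simps)
  also have "\<dots> / 2 = sqrt_bound (Suc (Suc n)) - ?s"
    by (simp add: power2_eq_square field_simps)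
  finally show ?case using z by simp
qed

text \<open>The increments of the iteration are dominated by the telescoping series of the bounded
  monotone sequence \<open>sqrt_bound\<close>, so the iterates converge in norm. Membership in the
  commutant, self-adjointness, positivity and the norm bound pass to the limit.\<close>

lemma sqrt_exists:
  fixes c :: "'h :: complex_hilbert_space \<Rightarrow>\<^sub>L 'h"
  assumes c: "c \<in> commutant S" and sa: "self_adjoint c" and norm: "norm c \<le> 1"
    and pos: "\<And>x. 0 \<le> Re (cinner (blinfun_apply c x) x)"
  obtains y where "y \<in> commutant S" "self_adjoint y" "norm y \<le> 1" "y + y = c + y \<odot> y"
    "\<And>x. 0 \<le> Re (cinner (blinfun_apply y x) x)"
proof -
  let ?Y = "sqrt_iter c"
  have mem: "?Y n \<in> commutant S" for n
    by (induction n) (auto intro!: commutant_intros c)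
  have saY: "self_adjoint (?Y n)" for n
    by (induction n) (simp_all add: sa)
  have posY: "0 \<le> Re (cinner (blinfun_apply (?Y n) x) x)" for n x
  proof (induction n)
    case (Suc n)
    have "0 \<le> Re (cinner (blinfun_apply (?Y n) x) (blinfun_apply (?Y n) x))"
      by (simp flip: norm_sq_eq_cinner)
    then show ?case
      using pos [of x] by (simp add: blinfun_simps cinner_simps self_adjointD [OF saY])
  qed simp
  have incr: "sqrt_bound n \<le> sqrt_bound (Suc n)" for n
    using sqrt_iter_increment [OF norm, of n] norm_ge_zero order_trans by (smt (verit))
  have "incseq sqrt_bound"
    by (rule incseq_SucI) (rule incr)
  then have "convergent sqrt_bound"
    using sqrt_bound_range by (intro Bseq_mono_convergent BseqI' [where K = 1]) (auto dest: incseqD)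
  then have "summable (\<lambda>n. sqrt_bound (Suc n) - sqrt_bound n)"
    unfolding summable_iff_convergent by (simp add: sum_lessThan_telescope convergent_diff_const_right_iff
        del: sqrt_bound.simps)
  then have "summable (\<lambda>n. norm (?Y (Suc n) - ?Y n))"
    by (rule summable_comparison_test' [where N = 0])
      (use sqrt_iter_increment [OF norm] in \<open>auto simp del: sqrt_iter.simps sqrt_bound.simps\<close>)
  then have "summable (\<lambda>n. ?Y (Suc n) - ?Y n)"
    by (rule summable_norm_cancel)
  then have "convergent (\<lambda>n. ?Y n - ?Y 0)"
    unfolding summable_iff_convergent by (simp only: sum_lessThan_telescope)
  then obtain y where y: "?Y \<longlonglongrightarrow> y"
    by (auto simp: convergent_def)
  show thesis
  proof
    show "y \<in> commutant S" by (rule commutant_limit [OF mem y])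
    show "self_adjoint y" by (rule self_adjoint_limit [OF saY y])
    show "norm y \<le> 1"
      by (rule LIMSEQ_le_const2 [OF tendsto_norm [OF y]])
        (use sqrt_iter_increment [OF norm] sqrt_bound_range order_trans in blast)
    show "0 \<le> Re (cinner (blinfun_apply y x) x)" for x
      by (rule LIMSEQ_le_const [OF tendsto_Re [OF tendsto_cinner_blinfun(1) [OF y]]]) (use posY in auto)
    have "(\<lambda>n. ?Y (Suc n)) \<longlonglongrightarrow> (1/2) *\<^sub>R (c + y \<odot> y)"
      unfolding sqrt_iter.simps
      by (intro tendsto_intros y bounded_bilinear.tendsto [OF bounded_bilinear_blinfun_compose])
    then have "y = (1/2) *\<^sub>R (c + y \<odot> y)"
      using LIMSEQ_Suc [OF y] LIMSEQ_unique by blast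
    then have "2 *\<^sub>R y = c + y \<odot> y"
      by (metis scaleR_scaleR scaleR_one nonzero_divide_eq_eq zero_neq_numeral times_divide_eq_right mult.right_neutral)
    then show "y + y = c + y \<odot> y" by (simp add: scaleR_2)
  qed
qed

text \<open>Expand \<open>0 \<le> \<langle>y (x - y x), x - y x\<rangle>\<close>.\<close>

lemma positive_contraction_square_le:
  fixes y :: "'h :: complex_hilbert_space \<Rightarrow>\<^sub>L 'h"
  assumes sa: "self_adjoint y" and "norm y \<le> 1"
    and pos: "\<And>x. 0 \<le> Re (cinner (blinfun_apply y x) x)"
  shows "(norm (blinfun_apply y x))\<^sup>2 \<le> Re (cinner (blinfun_apply y x) x)"
proof -
  let ?z = "blinfun_apply y x"
  have "Re (cinner (blinfun_apply y ?z) ?z) \<le> norm (blinfun_apply y ?z) * norm ?z"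
    by (rule Re_cinner_le)
  also have "\<dots> \<le> (1 * norm ?z) * norm ?z"
    using norm_blinfun [of y ?z] assms(2)
    by (intro mult_right_mono) (meson mult_right_mono norm_ge_zero order_trans)+
  finally have "Re (cinner (blinfun_apply y ?z) ?z) \<le> (norm ?z)\<^sup>2"
    by (simp add: power2_eq_square)
  moreover have "Re (cinner (blinfun_apply y (x - ?z)) (x - ?z)) =
      Re (cinner ?z x) - 2 * (norm ?z)\<^sup>2 + Re (cinner (blinfun_apply y ?z) ?z)"
    by (simp add: blinfun_simps cinner_simps norm_sq_eq_cinner self_adjointD [OF sa])
  ultimately show ?thesis
    using pos [of "x - ?z"] by linarith
qed

text \<open>\<open>s\<close> is the absolute value of \<open>x\<close>, found as 1 - y where y
  solves (1 - y)^2 = x^2. The last bound expresses 0 <= s <= 1 as a distance from 1/2, the form that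
  halving a spectral interval needs.\<close>

lemma absolute_value_exists:
  fixes x :: "'h :: complex_hilbert_space \<Rightarrow>\<^sub>L 'h"
  assumes x: "x \<in> commutant S" and sa: "self_adjoint x" and norm: "norm x \<le> 1"
  obtains s where "s \<in> commutant S" "self_adjoint s" "s \<odot> s = x \<odot> x"
    "norm (s - (1/2) *\<^sub>R id_blinfun) \<le> 1/2"
proof -
  define c where "c = id_blinfun - x \<odot> x"
  have contr: "norm (blinfun_apply x z) \<le> norm z" for z
    using norm_blinfun [of x z] mult_right_mono [OF norm, of "norm z"] by simp
  have quad: "Re (cinner (blinfun_apply c z) z) = (norm z)\<^sup>2 - (norm (blinfun_apply x z))\<^sup>2" for z
    by (simp add: c_def blinfun_simps cinner_simps norm_sq_eq_cinner self_adjointD [OF sa])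
  have xx: "cinner z (blinfun_apply x (blinfun_apply x z)) = of_real ((norm (blinfun_apply x z))\<^sup>2)" for z
    by (simp only: self_adjointD [OF sa, symmetric] cinner_self)
  \<comment> \<open>Expanding the square gives norm (c z)^2 = norm z^2 - 2 norm (x z)^2 + norm (x (x
    z))^2, and the last term is at most norm (x z)^2.\<close>
  have c1: "norm c \<le> 1"
  proof (rule norm_blinfun_bound)
    fix z
    have "(norm (blinfun_apply c z))\<^sup>2 =
        (norm z)\<^sup>2 - 2 * (norm (blinfun_apply x z))\<^sup>2 + (norm (blinfun_apply x (blinfun_apply x z)))\<^sup>2"
      by (simp add: c_def blinfun.diff_left norm_diff_sq xx)
    also have "\<dots> \<le> (norm z)\<^sup>2"
      using power_mono [OF contr [of "blinfun_apply x z"] norm_ge_zero, of 2]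
        zero_le_power2 [of "norm (blinfun_apply x z)"] by linarith
    finally show "norm (blinfun_apply c z) \<le> 1 * norm z"
      by simp
  qed simp
  obtain y where y: "y \<in> commutant S" "self_adjoint y" "norm y \<le> 1" "y + y = c + y \<odot> y"
    "\<And>z. 0 \<le> Re (cinner (blinfun_apply y z) z)"
  proof (rule sqrt_exists [OF _ _ c1])
    show "c \<in> commutant S" unfolding c_def by (intro commutant_intros x)
    show "self_adjoint c" unfolding c_def using sa by simp
    show "0 \<le> Re (cinner (blinfun_apply c z) z)" for z
      using power_mono [OF contr, of z 2] by (simp add: quad)
  qed blast
  show thesis
  proof
    show "id_blinfun - y \<in> commutant S" by (intro commutant_intros y)
    show "self_adjoint (id_blinfun - y)" using y by simp
    have "(id_blinfun - y) \<odot> (id_blinfun - y) = id_blinfun - (y + y) + y \<odot> y"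
      by (simp add: compose_simps)
    then show "(id_blinfun - y) \<odot> (id_blinfun - y) = x \<odot> x"
      by (simp add: y(4) c_def)
    show "norm (id_blinfun - y - (1/2) *\<^sub>R id_blinfun) \<le> 1/2"
    proof (rule norm_blinfun_bound)
      fix z
      let ?v = "blinfun_apply (id_blinfun - y - (1/2) *\<^sub>R id_blinfun) z"
      have v: "?v = (1/2) *\<^sub>R z - blinfun_apply y z"
        by (simp add: blinfun_simps) (simp flip: scaleR_add_left add: algebra_simps)
      have "(norm ?v)\<^sup>2 = (1/4) * (norm z)\<^sup>2 - Re (cinner (blinfun_apply y z) z) + (norm (blinfun_apply y z))\<^sup>2"
        unfolding v by (simp add: norm_diff_sq cinner_simps Re_cinner_commute [of z] power_divide)
      also have "\<dots> \<le> (1/2 * norm z)\<^sup>2"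
        using positive_contraction_square_le [OF y(2,3,5), of z] by (simp add: power2_eq_square)
      finally show "norm ?v \<le> 1/2 * norm z"
        by (rule power2_le_imp_le) simp
    qed simp
  qed
qed

text \<open>The projection \<open>f\<close> onto the kernel of \<open>\<bar>x\<bar> - x\<close> satisfies \<open>f x = f \<bar>x\<bar>\<close> and
  \<open>(1 - f) x = - (1 - f) \<bar>x\<bar>\<close>.\<close>

lemma spectral_bisection:
  fixes x :: "'h :: complex_hilbert_space \<Rightarrow>\<^sub>L 'h"
  assumes S: "S \<subseteq> bounded_operators" and abelian: "commutant S \<subseteq> S"
    and x: "x \<in> commutant S" "self_adjoint x" "norm x \<le> r" "0 < r"
    and e: "projection e" "x \<odot> e = x"
  obtains f where "projection f" "f \<in> commutant S"
    "norm (f \<odot> (x - (r/2) *\<^sub>R e)) \<le> r/2"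
    "norm ((id_blinfun - f) \<odot> (x + (r/2) *\<^sub>R e)) \<le> r/2"
proof -
  define x' where "x' = (1/r) *\<^sub>R x"
  have xx': "x = r *\<^sub>R x'" using \<open>0 < r\<close> by (simp add: x'_def)
  have x': "x' \<in> commutant S" "self_adjoint x'" "norm x' \<le> 1"
    using x by (auto simp: x'_def intro: commutant_intros)
  obtain s where s: "s \<in> commutant S" "self_adjoint s" "s \<odot> s = x' \<odot> x'"
    "norm (s - (1/2) *\<^sub>R id_blinfun) \<le> 1/2"
    using absolute_value_exists [OF x'] by blast
  have comm: "x' \<odot> s = s \<odot> x'"
    using s(1) x'(1) abelian by (auto simp: commutant_def)
  obtain f where f: "projection f" "f \<in> commutant S" "(s - x') \<odot> f = 0"
    "\<And>z. blinfun_apply (s - x') z = 0 \<Longrightarrow> blinfun_apply f z = z"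
  proof (rule kernel_projection [of "s - x'" S])
    show "s - x' \<in> commutant S" by (intro commutant_intros s x')
  qed (use S s x' in auto)
  have "f \<odot> (s - x') = 0"
    using f(2,3) s(1) x'(1) abelian commutant_diff [OF s(1) x'(1)] by (auto simp: commutant_def)
  then have fx: "f \<odot> x' = f \<odot> s"
    by (simp add: compose_simps)
  \<comment> \<open>This is s^2 - x'^2, since \<open>s\<close> and \<open>x'\<close> commute. Hence
    \<open>s + x'\<close> maps into the kernel of \<open>s - x'\<close> and is fixed by
    \<open>f\<close>, which determines \<open>x'\<close> on the complement of
    \<open>f\<close>.\<close>
  have "(s - x') \<odot> (s + x') = 0"
    by (simp add: compose_simps s(3) comm)
  then have "blinfun_apply f (blinfun_apply (s + x') z) = blinfun_apply (s + x') z" for z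
    by (intro f(4)) (metis blinfun_apply_blinfun_compose blinfun.zero_left)
  then have "f \<odot> (s + x') = s + x'"
    by (intro blinfun_eqI) simp
  then have gx: "(id_blinfun - f) \<odot> x' = - ((id_blinfun - f) \<odot> s)"
    by (simp add: compose_simps algebra_simps)
  have x'e: "x' \<odot> e = x'"
    using e(2) by (simp add: x'_def compose_simps)
  \<comment> \<open>On both halves the shifted operator is, up to sign, a compression of r (s - 1/2)
    e, whose norm is at most r/2.\<close>
  let ?t = "s - (1/2) *\<^sub>R id_blinfun"
  have bound: "norm (h \<odot> (r *\<^sub>R (?t \<odot> e))) \<le> r/2" if "projection h" for h
  proof -
    have "norm (h \<odot> (r *\<^sub>R (?t \<odot> e))) \<le> norm (r *\<^sub>R (?t \<odot> e))"
      by (rule norm_projection_compose_le [OF that])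
    also have "\<dots> \<le> r * norm ?t"
      using \<open>0 < r\<close> norm_compose_projection_le [OF e(1), of ?t] by simp
    also have "\<dots> \<le> r/2"
      using \<open>0 < r\<close> s(4) by simp
    finally show ?thesis .
  qed
  show thesis
  proof
    have "f \<odot> s \<odot> e = f \<odot> x' \<odot> e" by (simp add: fx)
    then have "f \<odot> (s \<odot> e) = f \<odot> x'" by (simp add: compose_assoc x'e)
    then have "f \<odot> (x - (r/2) *\<^sub>R e) = f \<odot> (r *\<^sub>R (?t \<odot> e))"
      by (simp add: xx' compose_simps algebra_simps)
    then show "norm (f \<odot> (x - (r/2) *\<^sub>R e)) \<le> r/2"
      using bound [OF f(1)] by simp
    let ?g = "id_blinfun - f"
    have "?g \<odot> s \<odot> e = - (?g \<odot> x') \<odot> e" by (simp add: gx)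
    then have "?g \<odot> (s \<odot> e) = - (?g \<odot> x')" by (simp only: compose_assoc compose_minus_left x'e)
    then have "?g \<odot> (r *\<^sub>R (?t \<odot> e)) = - (?g \<odot> (x + (r/2) *\<^sub>R e))"
      by (simp only: xx' compose_diff_right compose_diff_left [of s] compose_scaleR_right compose_scaleR_left
          compose_id compose_add_right scaleR_diff_right) simp
    then show "norm (?g \<odot> (x + (r/2) *\<^sub>R e)) \<le> r/2"
      using bound [OF projection_complement [OF f(1)]] by simp
  qed fact+
qed

section \<open>Localization of vectors in the spectrum\<close>

text \<open>Elements of \<open>commutant S\<close> commute with \<open>S\<close>, and by the first
  assumption with one another. The case in mind is \<open>S = commutant {a}\<close>, whose commutant
  is the bicommutant of \<open>a\<close>.\<close>

lemma abelian_commutant_commute: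
  assumes "commutant S \<subseteq> S" "x \<in> commutant S" "y \<in> commutant S"
  shows "x \<odot> y = y \<odot> x"
  using assms by (auto simp: commutant_def)

lemma compose_eq_apply:
  "a \<odot> b = c \<Longrightarrow> blinfun_apply a (blinfun_apply b x) = blinfun_apply c x"
  by (simp only: blinfun_apply_blinfun_compose [symmetric])

lemma projection_diff:
  assumes "projection p" "projection q" "p \<odot> q = q" "q \<odot> p = q"
  shows "projection (p - q)"
  using assms unfolding projection_def by (simp add: compose_simps)

text \<open>Halving the interval around \<open>l\<close> splits \<open>e v\<close> into two
  orthogonal pieces. By Pythagoras one of them carries at least half of the squared norm;
  \<open>e'\<close> selects it, and \<open>l'\<close> is l + r/2 or l - r/2.\<close>

lemma spectral_bisection_vector:
  fixes a :: "'h :: complex_hilbert_space \<Rightarrow>\<^sub>L 'h"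
  assumes S: "S \<subseteq> bounded_operators" and abelian: "commutant S \<subseteq> S"
    and a: "a \<in> commutant S" "self_adjoint a"
    and e: "projection e" "e \<in> commutant S"
    and r: "0 < r" "norm (e \<odot> (a - l *\<^sub>R id_blinfun)) \<le> r"
  obtains e' l' where "projection e'" "e' \<in> commutant S" "e' \<odot> e = e'" "\<bar>l' - l\<bar> \<le> r"
    "norm (e' \<odot> (a - l' *\<^sub>R id_blinfun)) \<le> r / 2"
    "(norm (blinfun_apply e v))\<^sup>2 / 2 \<le> (norm (blinfun_apply e' v))\<^sup>2"
proof -
  note comm = abelian_commutant_commute [OF abelian]
  define x where "x = e \<odot> (a - l *\<^sub>R id_blinfun)"
  have al: "a - l *\<^sub>R id_blinfun \<in> commutant S" "self_adjoint (a - l *\<^sub>R id_blinfun)"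
    using a by (auto intro: commutant_intros)
  have x: "x \<in> commutant S" "self_adjoint x" "x \<odot> e = x"
    unfolding x_def using al e comm [OF e(2) al(1)]
    by (auto intro!: commutant_intros self_adjoint_compose simp: compose_assoc)
  obtain f where f: "projection f" "f \<in> commutant S" "norm (f \<odot> (x - (r/2) *\<^sub>R e)) \<le> r/2"
    "norm ((id_blinfun - f) \<odot> (x + (r/2) *\<^sub>R e)) \<le> r/2"
    using spectral_bisection [OF S abelian x(1,2) _ r(1) e(1) x(3)] r(2) unfolding x_def by blast
  let ?g = "id_blinfun - f"
  have g: "projection ?g" "?g \<in> commutant S"
    using f by (auto intro: commutant_intros)
  have mem: "f \<odot> e \<in> commutant S" "?g \<odot> e \<in> commutant S"
    by (intro commutant_intros f g e)+
  have proj: "projection (f \<odot> e)" "projection (?g \<odot> e)"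
    by (intro projection_compose f g e comm)+
  have le: "(f \<odot> e) \<odot> e = f \<odot> e" "(?g \<odot> e) \<odot> e = ?g \<odot> e"
    using e(1) by (simp_all add: compose_assoc)
  have "f \<odot> (x - (r/2) *\<^sub>R e) = (f \<odot> e) \<odot> (a - (l + r/2) *\<^sub>R id_blinfun)"
    by (simp add: x_def compose_simps scaleR_add_left)
  then have n1: "norm ((f \<odot> e) \<odot> (a - (l + r/2) *\<^sub>R id_blinfun)) \<le> r/2"
    using f(3) by simp
  have "x + (r/2) *\<^sub>R e = e \<odot> (a - (l - r/2) *\<^sub>R id_blinfun)"
    by (simp add: x_def compose_simps scaleR_diff_left)
  then have n2: "norm ((?g \<odot> e) \<odot> (a - (l - r/2) *\<^sub>R id_blinfun)) \<le> r/2"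
    using f(4) by (simp only: compose_assoc)
  have "(norm (blinfun_apply e v))\<^sup>2 = (norm (blinfun_apply (f \<odot> e) v))\<^sup>2 + (norm (blinfun_apply (?g \<odot> e) v))\<^sup>2"
    using projection_pythagoras [OF f(1), of "blinfun_apply e v"] by (simp add: blinfun.diff_left)
  then consider "(norm (blinfun_apply e v))\<^sup>2 / 2 \<le> (norm (blinfun_apply (f \<odot> e) v))\<^sup>2"
    | "(norm (blinfun_apply e v))\<^sup>2 / 2 \<le> (norm (blinfun_apply (?g \<odot> e) v))\<^sup>2"
    by linarith
  then show thesis
  proof cases
    case 1
    show thesis by (rule that [OF proj(1) mem(1) le(1) _ n1 1]) (use r in simp)
  next
    case 2
    show thesis by (rule that [OF proj(2) mem(2) le(2) _ n2 2]) (use r in simp)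
  qed
qed

text \<open>A nonzero \<open>v\<close> is traced by bisection into spectral projections \<open>e n\<close> of \<open>a\<close> that belong to
  intervals of length of order \<open>2\<^sup>-\<^sup>n\<close> while \<open>\<parallel>e n v\<parallel>\<close> decreases at most like \<open>2\<^sup>-\<^sup>n\<^sup>/\<^sup>2\<close>. If \<open>v\<close> has no
  component in an eigenspace, then \<open>e n v\<close> tends to \<open>0\<close>, and differences of a sparse subsequence are
  orthogonal projections that violate the second assumption (a gliding hump).\<close>

lemma spectral_localization:
  fixes a :: "'h :: complex_hilbert_space \<Rightarrow>\<^sub>L 'h"
  assumes S: "S \<subseteq> bounded_operators" and abelian: "commutant S \<subseteq> S"
    and a: "a \<in> commutant S" "self_adjoint a"
    and eigen: "\<And>h l. projection h \<Longrightarrow> h \<in> commutant S \<Longrightarrow> h \<odot> (a - l *\<^sub>R id_blinfun) = 0 \<Longrightarrow>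
      blinfun_apply h v = 0"
    and hump: "\<And>(h :: nat \<Rightarrow> 'h \<Rightarrow>\<^sub>L 'h) c l. (\<And>k. projection (h k)) \<Longrightarrow> (\<And>k. h k \<in> commutant S) \<Longrightarrow>
      (\<And>j k. j \<noteq> k \<Longrightarrow> h j \<odot> h k = 0) \<Longrightarrow> (\<And>k. 1 \<le> c k) \<Longrightarrow>
      (\<And>k. norm (c k *\<^sub>R (h k \<odot> (a - l k *\<^sub>R id_blinfun))) \<le> (1/2) ^ k) \<Longrightarrow>
      \<exists>K. \<forall>k. c k * norm (blinfun_apply (h k) v) \<le> K"
  shows "v = 0"
proof (rule ccontr)
  assume "v \<noteq> 0"
  note comm = abelian_commutant_commute [OF abelian]
  \<comment> \<open>The norm of \<open>a\<close> bounds the first block, with the identity as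
    projection and centre 0; adding 1 keeps \<open>r\<close> positive when \<open>a\<close> is
    zero.\<close>
  define r where "r = norm a + 1"
  have "r > 0" by (simp add: r_def add_nonneg_pos)
  define P where "P n el \<longleftrightarrow> projection (fst el) \<and> fst el \<in> commutant S \<and>
    norm (fst el \<odot> (a - snd el *\<^sub>R id_blinfun)) \<le> r * (1/2) ^ n \<and>
    (1/2) ^ n * (norm v)\<^sup>2 \<le> (norm (blinfun_apply (fst el) v))\<^sup>2" for n and el :: "('h \<Rightarrow>\<^sub>L 'h) \<times> real"
  define Q where "Q n el el' \<longleftrightarrow> fst el' \<odot> fst el = fst el' \<and> \<bar>snd el' - snd el\<bar> \<le> r * (1/2) ^ n"
    for n :: nat and el el' :: "('h \<Rightarrow>\<^sub>L 'h) \<times> real"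
  have "P 0 (id_blinfun, 0)"
    by (simp add: P_def commutant_intros r_def)
  moreover have "\<exists>el'. P (Suc n) el' \<and> Q n el el'" if "P n el" for n el
  proof -
    have el: "projection (fst el)" "fst el \<in> commutant S"
      "norm (fst el \<odot> (a - snd el *\<^sub>R id_blinfun)) \<le> r * (1/2) ^ n"
      "(1/2) ^ n * (norm v)\<^sup>2 \<le> (norm (blinfun_apply (fst el) v))\<^sup>2"
      using that by (auto simp: P_def)
    have "0 < r * (1/2) ^ n" using \<open>r > 0\<close> by simp
    from spectral_bisection_vector [OF S abelian a el(1,2) this el(3), of v]
    obtain e' l' where "projection e'" "e' \<in> commutant S" "e' \<odot> fst el = e'"
      "\<bar>l' - snd el\<bar> \<le> r * (1/2) ^ n"
      "norm (e' \<odot> (a - l' *\<^sub>R id_blinfun)) \<le> r * (1/2) ^ n / 2"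
      "(norm (blinfun_apply (fst el) v))\<^sup>2 / 2 \<le> (norm (blinfun_apply e' v))\<^sup>2"
      by blast
    then have "P (Suc n) (e', l') \<and> Q n el (e', l')"
      using el(4) by (simp add: P_def Q_def)
    then show ?thesis by blast
  qed
  ultimately obtain el where el: "\<And>n. P n (el n)" "\<And>n. Q n (el n) (el (Suc n))"
    using dependent_nat_choice [of P Q] by blast
  define e where "e n = fst (el n)" for n
  define l where "l n = snd (el n)" for n
  have e: "projection (e n)" "e n \<in> commutant S" for n
    using el(1) [of n] by (simp_all add: P_def e_def)
  have small: "norm (e n \<odot> (a - l n *\<^sub>R id_blinfun)) \<le> r * (1/2) ^ n" for n
    using el(1) [of n] by (simp add: P_def e_def l_def)
  have big: "(1/2) ^ n * (norm v)\<^sup>2 \<le> (norm (blinfun_apply (e n) v))\<^sup>2" for n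
    using el(1) [of n] by (simp add: P_def e_def)
  have e_Suc: "e (Suc n) \<odot> e n = e (Suc n)" for n
    using el(2) [of n] by (simp add: Q_def e_def)
  have le: "e n \<odot> e m = e n" if "m \<le> n" for m n
    using that
  proof (induction n rule: dec_induct)
    case base then show ?case using e by simp
  next
    case (step n)
    have "e (Suc n) \<odot> e m = (e (Suc n) \<odot> e n) \<odot> e m" by (simp only: e_Suc)
    also have "\<dots> = e (Suc n) \<odot> e n" using step by (simp only: compose_assoc)
    finally show ?case by (simp only: e_Suc)
  qed
  have le': "e m \<odot> e n = e n" if "m \<le> n" for m n
    using le [OF that] comm [OF e(2) e(2)] by simp

  \<comment> \<open>The centres move by at most r 2^-n, so they converge; their limit
    \<open>L\<close> is the candidate for an eigenvalue.\<close>
  have "summable (\<lambda>n. r * (1/2) ^ n :: real)"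
    by (intro summable_mult summable_geometric) simp
  moreover have "norm (l (Suc n) - l n) \<le> r * (1/2) ^ n" for n
    using el(2) [of n] by (simp add: Q_def l_def)
  ultimately have "summable (\<lambda>n. l (Suc n) - l n)"
    by (rule summable_comparison_test' [where N = 0])
  then have "convergent (\<lambda>n. l n - l 0)"
    unfolding summable_iff_convergent by (simp only: sum_lessThan_telescope)
  then obtain L where L: "l \<longlonglongrightarrow> L"
    by (auto simp: convergent_diff_const_right_iff convergent_def)

  define u where "u n = blinfun_apply (e n) v" for n
  \<comment> \<open>For nested projections, Pythagoras turns convergence of the decreasing squared
    norms into the Cauchy property of the vectors themselves.\<close>
  have pyth: "(norm (u m - u n))\<^sup>2 = (norm (u m))\<^sup>2 - (norm (u n))\<^sup>2" if "m \<le> n" for m n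
  proof -
    have "blinfun_apply (e n) (u m) = u n"
      unfolding u_def by (rule compose_eq_apply [OF le [OF that]])
    then show ?thesis
      using projection_pythagoras [OF e(1), of "u m" n] by simp
  qed
  have "decseq (\<lambda>n. (norm (u n))\<^sup>2)"
    unfolding decseq_def using pyth by (smt (verit) zero_le_power2)
  then have "convergent (\<lambda>n. (norm (u n))\<^sup>2)"
    by (rule decseq_convergent [where B = 0]) (auto intro: convergentI)
  then have "Cauchy (\<lambda>n. (norm (u n))\<^sup>2)"
    by (rule convergent_Cauchy)
  have "Cauchy u"
    unfolding Cauchy_def
  proof (intro allI impI)
    fix d :: real assume "d > 0"
    then obtain N where N: "\<And>m n. m \<ge> N \<Longrightarrow> n \<ge> N \<Longrightarrow> dist ((norm (u m))\<^sup>2) ((norm (u n))\<^sup>2) < d\<^sup>2"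
      using \<open>Cauchy (\<lambda>n. (norm (u n))\<^sup>2)\<close> unfolding Cauchy_def by (meson zero_less_power)
    have *: "norm (u m - u n) < d" if "m \<ge> N" "n \<ge> N" "m \<le> n" for m n
    proof (rule power2_less_imp_less)
      show "(norm (u m - u n))\<^sup>2 < d\<^sup>2"
        using N [OF that(1,2)] pyth [OF that(3)] by (simp add: dist_real_def)
    qed (use \<open>d > 0\<close> in simp)
    have "dist (u m) (u n) < d" if "m \<ge> N" "n \<ge> N" for m n
      using * [of m n] * [of n m] that by (cases "m \<le> n") (auto simp: dist_norm norm_minus_commute)
    then show "\<exists>M. \<forall>m\<ge>M. \<forall>n\<ge>M. dist (u m) (u n) < d" by blast
  qed
  then obtain w where w: "u \<longlonglongrightarrow> w"
    using convergent_eq_Cauchy by blast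
  have ew: "blinfun_apply (e m) w = w" for m
  proof (rule LIMSEQ_unique)
    show "(\<lambda>n. blinfun_apply (e m) (u n)) \<longlonglongrightarrow> blinfun_apply (e m) w"
      by (rule bounded_linear.tendsto [OF blinfun.bounded_linear_right w])
    have "u n = blinfun_apply (e m) (u n)" if "m \<le> n" for n
      unfolding u_def by (rule compose_eq_apply [OF le' [OF that], symmetric])
    then have "eventually (\<lambda>n. u n = blinfun_apply (e m) (u n)) sequentially"
      by (rule eventually_sequentiallyI)
    then show "(\<lambda>n. blinfun_apply (e m) (u n)) \<longlonglongrightarrow> w"
      using w by (rule Lim_transform_eventually [rotated])
  qed
  have aL: "a - L *\<^sub>R id_blinfun \<in> commutant S" "self_adjoint (a - L *\<^sub>R id_blinfun)"
    using a by (auto intro: commutant_intros)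
  \<comment> \<open>The limit \<open>w\<close> is fixed by every \<open>e n\<close>, and on the
    range of \<open>e n\<close> the operator \<open>a\<close> differs from \<open>l n\<close> by at
    most r 2^-n.\<close>
  have "blinfun_apply (a - L *\<^sub>R id_blinfun) w = 0"
  proof (rule LIMSEQ_unique)
    show "(\<lambda>n. blinfun_apply (a - l n *\<^sub>R id_blinfun) w) \<longlonglongrightarrow> blinfun_apply (a - L *\<^sub>R id_blinfun) w"
      by (intro bounded_linear.tendsto [OF blinfun.bounded_linear_left] tendsto_diff tendsto_scaleR
          tendsto_const L)
    have bound: "norm (blinfun_apply (a - l n *\<^sub>R id_blinfun) w) \<le> r * (1/2) ^ n * norm w" for n
    proof -
      have "a - l n *\<^sub>R id_blinfun \<in> commutant S"
        by (intro commutant_intros a)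
      then have "(a - l n *\<^sub>R id_blinfun) \<odot> e n = e n \<odot> (a - l n *\<^sub>R id_blinfun)"
        by (rule comm [OF _ e(2)])
      then have "blinfun_apply (a - l n *\<^sub>R id_blinfun) w = blinfun_apply (e n \<odot> (a - l n *\<^sub>R id_blinfun)) w"
        using compose_eq_apply [of "a - l n *\<^sub>R id_blinfun" "e n" _ w] by (simp only: ew)
      then show ?thesis
        using norm_blinfun [of "e n \<odot> (a - l n *\<^sub>R id_blinfun)" w]
          mult_right_mono [OF small [of n] norm_ge_zero [of w]] by simp
    qed
    have "(\<lambda>n. r * (1/2) ^ n * norm w) \<longlonglongrightarrow> r * 0 * norm w"
      by (intro tendsto_mult tendsto_const LIMSEQ_power_zero) simp
    then have "(\<lambda>n. r * (1/2) ^ n * norm w) \<longlonglongrightarrow> 0"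
      by (simp only: mult_zero_left mult_zero_right)
    then show "(\<lambda>n. blinfun_apply (a - l n *\<^sub>R id_blinfun) w) \<longlonglongrightarrow> 0"
      by (rule Lim_null_comparison [OF always_eventually [OF allI [OF bound]]])
  qed
  moreover obtain k where k: "projection k" "k \<in> commutant S" "(a - L *\<^sub>R id_blinfun) \<odot> k = 0"
    "\<And>x. blinfun_apply (a - L *\<^sub>R id_blinfun) x = 0 \<Longrightarrow> blinfun_apply k x = x"
    using kernel_projection [OF aL(1) S aL(2)] by blast
  ultimately have "blinfun_apply k w = w" by simp
  \<comment> \<open>The kernel projection \<open>k\<close> of a - L fixes \<open>w\<close>. But it
    annihilates \<open>v\<close>, commutes with \<open>e n\<close> and so annihilates every
    \<open>u n\<close>, hence also their limit \<open>w\<close>; therefore w = 0.\<close>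
  have "blinfun_apply k v = 0"
    by (rule eigen [OF k(1,2)]) (use k(3) comm [OF k(2) aL(1)] in simp)
  then have "blinfun_apply k (u n) = 0" for n
    using compose_eq_apply [OF comm [OF k(2) e(2)], of n v] by (simp add: u_def)
  moreover have "(\<lambda>n. blinfun_apply k (u n)) \<longlonglongrightarrow> blinfun_apply k w"
    by (rule bounded_linear.tendsto [OF blinfun.bounded_linear_right w])
  ultimately have "w = 0"
    using \<open>blinfun_apply k w = w\<close> by (simp add: LIMSEQ_const_iff)
  have u0: "(\<lambda>n. norm (u n)) \<longlonglongrightarrow> 0"
    using tendsto_norm [OF w] by (simp add: \<open>w = 0\<close>)
  have upos: "0 < norm (u n)" for n
  proof -
    have "0 < (1/2) ^ n * (norm v)\<^sup>2" using \<open>v \<noteq> 0\<close> by simp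
    also have "\<dots> \<le> (norm (u n))\<^sup>2" using big [of n] by (simp only: u_def)
    finally show ?thesis by simp
  qed

  \<comment> \<open>Starting the subsequence at \<open>n0\<close> makes the multipliers
    \<open>c k\<close> at least 1.\<close>
  obtain n0 where n0: "r < 2 ^ n0"
    using real_arch_pow [of 2 r] by auto
  \<comment> \<open>The gap 4 gives \<open>n k\<close> >= 4 k, so that 2^(n k) / 4^k still grows at
    least like 4^k. Halving the norm leaves the difference of consecutive vectors at least half as
    long as the first of them.\<close>
  have "\<exists>n' \<ge> n + 4. norm (u n') \<le> norm (u n) / 2" for n
  proof -
    have "eventually (\<lambda>m. norm (u m) < norm (u n) / 2) sequentially"
      using u0 upos [of n] by (intro order_tendstoD(2)) auto
    then have "eventually (\<lambda>m. m \<ge> n + 4 \<and> norm (u m) < norm (u n) / 2) sequentially"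
      by (intro eventually_conj eventually_ge_at_top)
    then obtain m where "m \<ge> n + 4 \<and> norm (u m) < norm (u n) / 2"
      by (rule eventually_happens' [OF sequentially_bot, THEN exE])
    then show ?thesis by (intro exI [of _ m]) simp
  qed
  then have "\<exists>n. n 0 = n0 \<and> (\<forall>k. n (Suc k) \<ge> n k + 4 \<and> norm (u (n (Suc k))) \<le> norm (u (n k)) / 2)"
    using dependent_nat_choice [where P = "\<lambda>k m. k = 0 \<longrightarrow> m = n0"
        and Q = "\<lambda>k m m'. m' \<ge> m + 4 \<and> norm (u m') \<le> norm (u m) / 2"] by blast
  then obtain n where n: "n 0 = n0" "\<And>k. n (Suc k) \<ge> n k + 4"
    "\<And>k. norm (u (n (Suc k))) \<le> norm (u (n k)) / 2"
    by blast
  have nk: "n0 + 4 * k \<le> n k" for k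
  proof (induction k)
    case (Suc k)
    then show ?case using n(2) [of k] by simp
  qed (simp add: n)
  have "n k \<le> n (Suc k)" for k
    using n(2) [of k] by linarith
  then have nmono: "n j \<le> n k" if "j \<le> k" for j k
    using that by (rule lift_Suc_mono_le)
  define h where "h k = e (n k) - e (n (Suc k))" for k
  \<comment> \<open>Chosen so that \<open>c k\<close> times the block size r 2^-(n k) is exactly
    2^-k, the bound that \<open>hump\<close> asks for.\<close>
  define c where "c k = 2 ^ n k / (r * 2 ^ k)" for k
  have "\<exists>K. \<forall>k. c k * norm (blinfun_apply (h k) v) \<le> K"
  proof (rule hump [where l = "\<lambda>k. l (n k)"])
    fix k
    have mono: "n k \<le> n (Suc k)" by (rule nmono) simp
    show "projection (h k)"
      unfolding h_def by (intro projection_diff e le le' mono)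
    show "h k \<in> commutant S"
      unfolding h_def by (intro commutant_intros e)
    have "(2::real) ^ (n0 + k) \<le> 2 ^ n k"
      using nk [of k] by (intro power_increasing) auto
    then have "2 ^ n0 * 2 ^ k \<le> (2::real) ^ n k"
      by (simp add: power_add)
    then have "r * 2 ^ k \<le> (2::real) ^ n k"
      by (rule order_trans [rotated]) (use n0 in simp)
    then show "1 \<le> c k"
      using \<open>r > 0\<close> by (simp add: c_def)
    have ck: "c k * (r * (1/2) ^ n k) = (1/2) ^ k" "0 \<le> c k"
      using \<open>r > 0\<close> by (simp_all add: c_def power_one_over field_simps)
    let ?x = "a - l (n k) *\<^sub>R id_blinfun"
    have "h k \<odot> e (n k) = h k"
      using e le [OF mono] by (simp add: h_def compose_simps)
    then have "h k \<odot> ?x = h k \<odot> (e (n k) \<odot> ?x)"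
      by (simp flip: compose_assoc)
    then have "norm (h k \<odot> ?x) \<le> norm (e (n k) \<odot> ?x)"
      using norm_projection_compose_le [OF \<open>projection (h k)\<close>] by simp
    also have "\<dots> \<le> r * (1/2) ^ n k"
      by (rule small)
    finally have "c k * norm (h k \<odot> ?x) \<le> c k * (r * (1/2) ^ n k)"
      using ck(2) by (rule mult_left_mono)
    then show "norm (c k *\<^sub>R (h k \<odot> ?x)) \<le> (1/2) ^ k"
      using ck by simp
  next
    fix j k :: nat assume "j \<noteq> k"
    have *: "h j \<odot> h k = 0 \<and> h k \<odot> h j = 0" if "j < k" for j k
    proof -
      have "n j \<le> n k" "n (Suc j) \<le> n k" "n j \<le> n (Suc k)" "n (Suc j) \<le> n (Suc k)"
        using that by (auto intro!: nmono)
      then show ?thesis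
        by (simp add: h_def compose_simps le le')
    qed
    show "h j \<odot> h k = 0"
      using * [of j k] * [of k j] \<open>j \<noteq> k\<close> by (cases "j < k") auto
  qed
  then obtain K where K: "\<And>k. c k * norm (blinfun_apply (h k) v) \<le> K"
    by blast
  \<comment> \<open>The squared norm of the block of \<open>v\<close> is at least 2^-(n k) norm v^2
    / 4, while \<open>c k\<close> squared is of order 4^(n k) / 4^k; their product outgrows every
    bound.\<close>
  have "4 ^ k * ((norm v)\<^sup>2 / (4 * r\<^sup>2)) \<le> K\<^sup>2" for k
  proof -
    have c0: "0 \<le> c k" using \<open>r > 0\<close> by (simp add: c_def)
    have four: "(4::real) ^ k = 2 ^ k * 2 ^ k"
      by (simp flip: power_mult_distrib)
    have "(4::real) ^ k * 4 ^ k = 2 ^ (4 * k)"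
      by (simp add: power_mult flip: power_mult_distrib)
    also have "\<dots> \<le> 2 ^ n k"
      using nk [of k] by (intro power_increasing) auto
    finally have "(4::real) ^ k \<le> 2 ^ n k / 4 ^ k"
      by (simp add: pos_le_divide_eq)
    then have "4 ^ k * ((norm v)\<^sup>2 / (4 * r\<^sup>2)) \<le> 2 ^ n k / 4 ^ k * ((norm v)\<^sup>2 / (4 * r\<^sup>2))"
      by (rule mult_right_mono) simp
    also have "\<dots> = (c k)\<^sup>2 * ((1/2) ^ n k * (norm v)\<^sup>2) / 4"
      unfolding four c_def power_one_over power2_eq_square using \<open>r > 0\<close> by (simp add: field_simps)
    also have "\<dots> \<le> (c k)\<^sup>2 * (norm (u (n k)))\<^sup>2 / 4"
      using big [of "n k"] by (intro divide_right_mono mult_left_mono) (auto simp: u_def)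
    also have "\<dots> = (c k * (norm (u (n k)) / 2))\<^sup>2"
      by (simp add: power_mult_distrib power_divide)
    also have "\<dots> \<le> (c k * norm (blinfun_apply (h k) v))\<^sup>2"
    proof (intro power_mono mult_left_mono c0)
      have "norm (u (n k)) - norm (u (n (Suc k))) \<le> norm (u (n k) - u (n (Suc k)))"
        by (rule norm_triangle_ineq2)
      then show "norm (u (n k)) / 2 \<le> norm (blinfun_apply (h k) v)"
        using n(3) [of k] by (simp add: h_def u_def blinfun.diff_left)
    qed (use c0 in simp)
    also have "\<dots> \<le> K\<^sup>2"
      using K c0 by (intro power_mono) auto
    finally show ?thesis .
  qed
  moreover have pos: "(norm v)\<^sup>2 / (4 * r\<^sup>2) > 0"
    using \<open>v \<noteq> 0\<close> \<open>r > 0\<close> by simp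
  moreover obtain k where "K\<^sup>2 / ((norm v)\<^sup>2 / (4 * r\<^sup>2)) < 4 ^ k"
    using real_arch_pow [of 4 "K\<^sup>2 / ((norm v)\<^sup>2 / (4 * r\<^sup>2))"] by auto
  then have "K\<^sup>2 < 4 ^ k * ((norm v)\<^sup>2 / (4 * r\<^sup>2))"
    by (simp only: pos_divide_less_eq [OF pos])
  ultimately show False
    using not_less by blast
qed

section \<open>Maps that respect orthogonality\<close>

lemma is_adjoint_compose: "is_adjoint a b \<Longrightarrow> is_adjoint c d \<Longrightarrow> is_adjoint (a \<odot> c) (d \<odot> b)"
  by (simp add: is_adjoint_def)

lemma is_adjoint_sym: "is_adjoint a b \<Longrightarrow> is_adjoint b a"
  unfolding is_adjoint_def by (metis cinner_commute)

lemma is_adjoint_unique_left: "is_adjoint a c \<Longrightarrow> is_adjoint b c \<Longrightarrow> a = b"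
  using is_adjoint_unique is_adjoint_sym by blast

lemma compose_left_commute: "x \<odot> y = y \<odot> x \<Longrightarrow> x \<odot> (y \<odot> z) = y \<odot> (x \<odot> z)"
  by (simp flip: compose_assoc)

lemma compose_left_zero: "x \<odot> y = 0 \<Longrightarrow> x \<odot> (y \<odot> z) = 0"
  by (simp flip: compose_assoc)

lemma norm_compose_le: "norm x \<le> c \<Longrightarrow> norm y \<le> d \<Longrightarrow> norm (x \<odot> y) \<le> c * d"
  by (rule order_trans [OF norm_blinfun_compose]) (auto intro: mult_mono order_trans [OF norm_ge_zero])

section \<open>Von Neumann algebras and the bicommutant of one element\<close>

lemma von_neumann_algebra_mem:
  assumes "von_neumann_algebra M"
  shows "M \<subseteq> bounded_operators" "commutant (commutant M) = M"
  using assms by (simp_all add: von_neumann_algebra_def)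

lemma von_neumann_algebra_closed:
  assumes "von_neumann_algebra M"
  shows "x \<in> M \<Longrightarrow> y \<in> M \<Longrightarrow> x + y \<in> M" "x \<in> M \<Longrightarrow> y \<in> M \<Longrightarrow> x - y \<in> M"
    "x \<in> M \<Longrightarrow> y \<in> M \<Longrightarrow> x \<odot> y \<in> M" "x \<in> M \<Longrightarrow> t *\<^sub>R x \<in> M" "id_blinfun \<in> M"
  using commutant_intros [where S = "commutant M"] von_neumann_algebra_mem(2) [OF assms]
  by simp_all

text \<open>Taking commutants reverses inclusions. Applied to
  \<open>{a} \<subseteq> commutant {a}\<close> this makes the bicommutant of \<open>a\<close>
  abelian, and applied twice to \<open>{a} \<subseteq> M\<close> it places the bicommutant inside
  \<open>M\<close>.\<close>

lemma bicommutant_singleton: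
  assumes M: "von_neumann_algebra M" and a: "a \<in> M"
  shows "commutant {a} \<subseteq> bounded_operators"
    and "commutant (commutant {a}) \<subseteq> commutant {a}"
    and "a \<in> commutant (commutant {a})"
    and "commutant (commutant {a}) \<subseteq> M"
proof -
  have "a \<in> bounded_operators"
    using von_neumann_algebra_mem(1) [OF M] a by auto
  then show "commutant {a} \<subseteq> bounded_operators" "commutant (commutant {a}) \<subseteq> commutant {a}"
    "a \<in> commutant (commutant {a})"
    by (auto simp: commutant_def)
  have "commutant M \<subseteq> commutant {a}"
    using a by (auto simp: commutant_def)
  then have "commutant (commutant {a}) \<subseteq> commutant (commutant M)"
    by (auto simp: commutant_def)
  then show "commutant (commutant {a}) \<subseteq> M"
    by (simp add: von_neumann_algebra_mem(2) [OF M])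
qed

text \<open>The multipliers may be unbounded: only the blocks need be small for the series to
  converge in norm, and orthogonality recovers each block from the sum. This sum is the test element
  of the gliding hump.\<close>

lemma orthogonal_series:
  fixes h :: "nat \<Rightarrow> 'h :: complex_hilbert_space \<Rightarrow>\<^sub>L 'h"
  assumes S: "commutant S \<subseteq> S" and a: "a \<in> commutant S" "self_adjoint a"
    and h: "\<And>k. projection (h k)" "\<And>k. h k \<in> commutant S" "\<And>j k. j \<noteq> k \<Longrightarrow> h j \<odot> h k = 0"
    and small: "\<And>k. norm (c k *\<^sub>R (h k \<odot> (a - l k *\<^sub>R id_blinfun))) \<le> (1/2) ^ k"
  obtains x where "x \<in> commutant S" "self_adjoint x"
    "\<And>k. h k \<odot> x = c k *\<^sub>R (h k \<odot> (a - l k *\<^sub>R id_blinfun))"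
proof -
  define b where "b k = c k *\<^sub>R (h k \<odot> (a - l k *\<^sub>R id_blinfun))" for k
  have al: "a - t *\<^sub>R id_blinfun \<in> commutant S" for t
    by (intro commutant_intros a)
  have b: "b k \<in> commutant S" for k
    unfolding b_def by (intro commutant_intros h al)
  have sab: "self_adjoint (b k)" for k
    unfolding b_def using a h abelian_commutant_commute [OF S h(2) al]
    by (intro self_adjoint_scaleR self_adjoint_compose) auto
  have "summable (\<lambda>k. (1/2 :: real) ^ k)"
    by (intro summable_geometric) simp
  then have "summable b"
    by (rule summable_comparison_test' [where N = 0]) (simp add: b_def small del: norm_scaleR)
  then have lim: "(\<lambda>n. \<Sum>k<n. b k) \<longlonglongrightarrow> suminf b"
    by (rule summable_LIMSEQ)
  show thesis
  proof
    have "(\<Sum>k<n. b k) \<in> commutant S" for n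
      by (induction n) (auto intro: commutant_intros b)
    then show "suminf b \<in> commutant S"
      by (rule commutant_limit [OF _ lim])
    have "self_adjoint (\<Sum>k<n. b k)" for n
      by (induction n) (simp_all add: sab)
    then show "self_adjoint (suminf b)"
      by (rule self_adjoint_limit [OF _ lim])
    fix k
    have "h k \<odot> b j = (if j = k then b k else 0)" for j
      using h(1) [of k] h(3) [of k j]
      by (auto simp: b_def compose_scaleR_right projection_idem_left compose_left_zero)
    then have "(\<lambda>j. h k \<odot> b j) sums b k"
      using sums_single [of k "\<lambda>_. b k"] by (simp only:)
    moreover have "(\<lambda>j. h k \<odot> b j) sums (h k \<odot> suminf b)"
      using \<open>summable b\<close>
      by (intro bounded_linear.sums [OF bounded_bilinear.bounded_linear_right [OF bounded_bilinear_blinfun_compose]]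
          summable_sums)
    ultimately show "h k \<odot> suminf b = c k *\<^sub>R (h k \<odot> (a - l k *\<^sub>R id_blinfun))"
      using sums_unique2 by (metis b_def)
  qed
qed

text \<open>Only self-adjoint arguments and real scalars occur, so that the conditions hold for
  \<open>T\<close> and equally for the map sending x to the adjoint of T x, which is
  conjugate-linear.\<close>

locale local_map =
  fixes M :: "('h :: complex_hilbert_space \<Rightarrow>\<^sub>L 'h) set"
    and R :: "('h \<Rightarrow>\<^sub>L 'h) \<Rightarrow> ('h \<Rightarrow>\<^sub>L 'h)"
  assumes vn: "von_neumann_algebra M"
    and add: "x \<in> M \<Longrightarrow> self_adjoint x \<Longrightarrow> y \<in> M \<Longrightarrow> self_adjoint y \<Longrightarrow> R (x + y) = R x + R y"
    and scale: "x \<in> M \<Longrightarrow> self_adjoint x \<Longrightarrow> R (t *\<^sub>R x) = t *\<^sub>R R x"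
    and local_diag: "projection p \<Longrightarrow> p \<in> M \<Longrightarrow> x \<in> M \<Longrightarrow> self_adjoint x \<Longrightarrow>
      x \<odot> p = 0 \<Longrightarrow> p \<odot> x = 0 \<Longrightarrow> p \<odot> R x \<odot> p = 0"
begin

lemmas closed = von_neumann_algebra_closed [OF vn]

lemma diff: "x \<in> M \<Longrightarrow> self_adjoint x \<Longrightarrow> y \<in> M \<Longrightarrow> self_adjoint y \<Longrightarrow> R (x - y) = R x - R y"
  using add [of x "(-1) *\<^sub>R y"] scale [of y "-1"] closed(4) [of y "-1"]
    self_adjoint_scaleR [of y "-1"] by simp

text \<open>Locality for the projection \<open>p + q\<close> kills the whole compression of
  \<open>R x\<close>; multiplying by \<open>p\<close> and \<open>q\<close> cuts out the mixed
  block.\<close>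

lemma local_off_diag:
  assumes p: "projection p" "p \<in> M" and q: "projection q" "q \<in> M" and pq: "p \<odot> q = 0" "q \<odot> p = 0"
    and x: "x \<in> M" "self_adjoint x" "x \<odot> p = 0" "p \<odot> x = 0" "x \<odot> q = 0" "q \<odot> x = 0"
  shows "p \<odot> R x \<odot> q = 0"
proof -
  have "projection (p + q)"
    using p q pq unfolding projection_def by (simp add: compose_simps)
  then have "(p + q) \<odot> R x \<odot> (p + q) = 0"
    using p q x by (intro local_diag closed) (simp_all add: compose_simps)
  then have "p \<odot> ((p + q) \<odot> R x \<odot> (p + q)) \<odot> q = 0"
    by simp
  moreover have "p \<odot> (p + q) = p" "(p + q) \<odot> q = q"
    using p q pq by (simp_all add: compose_simps)
  ultimately show ?thesis
    by (simp add: compose_assoc) (simp flip: compose_assoc)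
qed

text \<open>The difference of the two arguments of \<open>R\<close> is (1 - h) e y, which the
  orthogonal projections \<open>h e\<close> and \<open>f\<close> annihilate on both sides. So the
  block at \<open>h\<close> sees only the part of \<open>y\<close> under \<open>h\<close>.\<close>

lemma restrict_off_diag:
  assumes h: "projection h" "h \<in> M" and e: "projection e" "e \<in> M" and f: "projection f" "f \<in> M"
    and y: "y \<in> M" "self_adjoint y" and ef: "e \<odot> f = 0" "f \<odot> e = 0"
    and comm: "e \<odot> h = h \<odot> e" "f \<odot> h = h \<odot> f" "y \<odot> h = h \<odot> y" "e \<odot> y = y \<odot> e" "f \<odot> y = y \<odot> f"
  shows "h \<odot> e \<odot> R (e \<odot> y) \<odot> f = h \<odot> e \<odot> R (h \<odot> e \<odot> y) \<odot> f"
proof -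
  note simps = comm comm [THEN compose_left_commute] ef ef [THEN compose_left_zero]
    projection_idem [OF h(1)] projection_idem [OF e(1)] projection_idem_left [OF h(1)]
    projection_idem_left [OF e(1)] compose_simps
  have he: "projection (h \<odot> e)" "h \<odot> e \<in> M"
    using comm by (auto intro!: projection_compose h e closed)
  have sa: "self_adjoint (e \<odot> y)" "self_adjoint (h \<odot> e \<odot> y)"
    using he(1) e y by - (rule self_adjoint_compose; simp add: simps)+
  have mem: "e \<odot> y \<in> M" "h \<odot> e \<odot> y \<in> M"
    by (intro closed h e y)+
  have "h \<odot> e \<odot> R (e \<odot> y - h \<odot> e \<odot> y) \<odot> f = 0"
    by (rule local_off_diag) (use he f mem sa closed in \<open>simp_all add: simps\<close>)
  then have "h \<odot> e \<odot> R (e \<odot> y) \<odot> f - h \<odot> e \<odot> R (h \<odot> e \<odot> y) \<odot> f = 0"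
    by (simp only: diff [OF mem(1) sa(1) mem(2) sa(2)] compose_diff_left compose_diff_right)
  then show ?thesis by simp
qed

text \<open>For scalar \<open>a\<close> this is homogeneity of \<open>R\<close>. In general
  \<open>a\<close> is nearly scalar on short spectral intervals, and the gliding hump replaces the
  missing continuity of \<open>R\<close>.\<close>

lemma off_diag:
  assumes a: "a \<in> M" "self_adjoint a" and e: "projection e" "e \<in> M" and f: "projection f" "f \<in> M"
    and ef: "e \<odot> f = 0" "f \<odot> e = 0" and comm: "e \<odot> a = a \<odot> e" "f \<odot> a = a \<odot> f"
  shows "e \<odot> R (e \<odot> a) \<odot> f = a \<odot> (e \<odot> R e \<odot> f)"
proof -
  define w where "w = e \<odot> R e \<odot> f"
  define z where "z = e \<odot> R (e \<odot> a) \<odot> f - a \<odot> w"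
  let ?S = "commutant {a}"
  note S = bicommutant_singleton [OF vn a(1)]
  have eS: "e \<in> ?S" "f \<in> ?S"
    using e f comm von_neumann_algebra_mem(1) [OF vn] by (auto simp: commutant_def)
  have commS: "x \<odot> y = y \<odot> x" if "y \<in> commutant ?S" "x \<in> ?S" for x y
    using that by (auto simp: commutant_def)
  have restrict: "h \<odot> e \<odot> R (e \<odot> y) \<odot> f = h \<odot> e \<odot> R (h \<odot> e \<odot> y) \<odot> f"
    if h: "projection h" "h \<in> commutant ?S" and y: "y \<in> commutant ?S" "self_adjoint y" for h y
    using h y e f ef S(2,4) eS
    by (intro restrict_off_diag) (auto intro!: commS)
  have restrict1: "h \<odot> w = h \<odot> e \<odot> R (h \<odot> e) \<odot> f"
    if h: "projection h" "h \<in> commutant ?S" for h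
    using restrict [OF h commutant_subalgebra(1)] by (simp add: w_def compose_assoc)
  have heM: "h \<odot> e \<in> M" "self_adjoint (h \<odot> e)" "h \<odot> e \<odot> a \<in> M" "self_adjoint (h \<odot> e \<odot> a)"
    if h: "projection h" "h \<in> commutant ?S" for h
  proof -
    have ha: "h \<odot> a = a \<odot> h" "e \<odot> h = h \<odot> e"
      using commS [OF h(2)] eS S(2,3) by auto
    show "h \<odot> e \<in> M" "h \<odot> e \<odot> a \<in> M"
      using h S(4) by (auto intro!: closed e a)
    show sa: "self_adjoint (h \<odot> e)"
      using h e ha by (intro self_adjoint_compose) simp_all
    show "self_adjoint (h \<odot> e \<odot> a)"
      by (rule self_adjoint_compose [OF sa a(2)])
        (simp add: compose_assoc comm ha compose_left_commute [OF ha(1) [symmetric]])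
  qed
  have "blinfun_apply z \<xi> = 0" for \<xi>
  proof (rule spectral_localization [OF S(1,2,3) a(2)])
    fix h and t :: real
    assume h: "projection h" "h \<in> commutant ?S" and "h \<odot> (a - t *\<^sub>R id_blinfun) = 0"
    then have ha: "h \<odot> a = t *\<^sub>R h"
      by (simp add: compose_simps)
    have "h \<odot> e \<odot> a = t *\<^sub>R (h \<odot> e)"
      by (simp add: compose_assoc comm) (simp add: ha compose_scaleR_left flip: compose_assoc)
    then have "h \<odot> (e \<odot> R (e \<odot> a) \<odot> f) = t *\<^sub>R (h \<odot> w)"
      using restrict [OF h S(3) a(2)] heM [OF h]
      by (simp add: restrict1 [OF h] scale compose_simps)
    moreover have "h \<odot> (a \<odot> w) = t *\<^sub>R (h \<odot> w)"
      by (simp add: ha compose_scaleR_left flip: compose_assoc)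
    ultimately have "h \<odot> z = 0"
      by (simp add: z_def compose_diff_right)
    then show "blinfun_apply h (blinfun_apply z \<xi>) = 0"
      by (simp add: compose_eq_apply)
  next
    fix h :: "nat \<Rightarrow> 'h \<Rightarrow>\<^sub>L 'h" and c l :: "nat \<Rightarrow> real"
    assume h: "\<And>k. projection (h k)" "\<And>k. h k \<in> commutant ?S" "\<And>j k. j \<noteq> k \<Longrightarrow> h j \<odot> h k = 0"
      and c: "\<And>k. 1 \<le> c k"
      and small: "\<And>k. norm (c k *\<^sub>R (h k \<odot> (a - l k *\<^sub>R id_blinfun))) \<le> (1/2) ^ k"
    obtain x where x: "x \<in> commutant ?S" "self_adjoint x"
      "\<And>k. h k \<odot> x = c k *\<^sub>R (h k \<odot> (a - l k *\<^sub>R id_blinfun))"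
      using orthogonal_series [OF S(2,3) a(2) h small] by blast
    have "c k * norm (blinfun_apply (h k) (blinfun_apply z \<xi>)) \<le> (norm (e \<odot> R (e \<odot> x) \<odot> f) + 1 * norm w) * norm \<xi>" for k
    proof -
      note hk = h(1,2) [of k]
      let ?b = "c k *\<^sub>R (h k \<odot> (a - l k *\<^sub>R id_blinfun))"
      have "h k \<odot> e \<odot> x = c k *\<^sub>R (h k \<odot> e \<odot> a - l k *\<^sub>R (h k \<odot> e))"
      proof -
        have "h k \<odot> e \<odot> x = (h k \<odot> x) \<odot> e"
          using commS [OF x(1) eS(1)] by (simp add: compose_assoc)
        then show ?thesis
          unfolding x(3) by (simp add: compose_simps comm)
      qed
      then have "h k \<odot> e \<odot> R (e \<odot> x) \<odot> f =
          c k *\<^sub>R (h k \<odot> e \<odot> R (h k \<odot> e \<odot> a) \<odot> f - l k *\<^sub>R (h k \<odot> w))"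
        using restrict [OF hk x(1,2)] heM [OF hk]
        by (simp add: restrict1 [OF hk] scale diff closed compose_simps)
      also have "h k \<odot> e \<odot> R (h k \<odot> e \<odot> a) \<odot> f = h k \<odot> e \<odot> R (e \<odot> a) \<odot> f"
        using restrict [OF hk S(3) a(2)] by simp
      \<comment> \<open>The first term on the right comes from the single element \<open>x\<close>,
        the second contains the small block \<open>?b\<close>. So the right-hand side stays bounded
        in \<open>k\<close> although \<open>c k\<close> need not.\<close>
      finally have "c k *\<^sub>R (h k \<odot> z) = h k \<odot> (e \<odot> R (e \<odot> x) \<odot> f) - ?b \<odot> w"
        by (simp add: z_def compose_simps algebra_simps)
      moreover have "norm (h k \<odot> (e \<odot> R (e \<odot> x) \<odot> f)) \<le> norm (e \<odot> R (e \<odot> x) \<odot> f)"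
        by (rule norm_projection_compose_le [OF hk(1)])
      moreover have "norm (?b \<odot> w) \<le> 1 * norm w"
        using order_trans [OF small [of k]] power_le_one [of "1/2 :: real" k]
        by (intro norm_compose_le) auto
      ultimately have "norm (c k *\<^sub>R (h k \<odot> z)) \<le> norm (e \<odot> R (e \<odot> x) \<odot> f) + 1 * norm w"
        by (metis add_mono norm_triangle_le_diff)
      then have "norm (blinfun_apply (c k *\<^sub>R (h k \<odot> z)) \<xi>) \<le> (norm (e \<odot> R (e \<odot> x) \<odot> f) + 1 * norm w) * norm \<xi>"
        by (rule order_trans [OF norm_blinfun mult_right_mono]) simp
      then show ?thesis
        using c [of k] by (simp add: blinfun.scaleR_left)
    qed
    then show "\<exists>K. \<forall>k. c k * norm (blinfun_apply (h k) (blinfun_apply z \<xi>)) \<le> K"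
      by blast
  qed
  then have "z = 0"
    by (intro blinfun_eqI) simp
  then show ?thesis
    by (simp add: z_def w_def)
qed

end

section \<open>Jordan derivations on semiprime rings\<close>

text \<open>The multiplication is a parameter because composition does not make the type of bounded
  operators an instance of class \<^class>\<open>ring\<close>.\<close>

locale jordan_derivation_semiprime =
  fixes mult :: "'a :: real_vector \<Rightarrow> 'a \<Rightarrow> 'a" (infixl "\<cdot>" 70)
    and R :: "'a set" and T :: "'a \<Rightarrow> 'a"
  assumes add_left: "(x + y) \<cdot> z = x \<cdot> z + y \<cdot> z"
    and add_right: "x \<cdot> (y + z) = x \<cdot> y + x \<cdot> z"
    and assoc: "x \<cdot> y \<cdot> z = x \<cdot> (y \<cdot> z)"
    and R_diff [simp]: "x \<in> R \<Longrightarrow> y \<in> R \<Longrightarrow> x - y \<in> R"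
    and R_mult [simp]: "x \<in> R \<Longrightarrow> y \<in> R \<Longrightarrow> x \<cdot> y \<in> R"
    and R_T [simp]: "x \<in> R \<Longrightarrow> T x \<in> R"
    and T_add: "x \<in> R \<Longrightarrow> y \<in> R \<Longrightarrow> T (x + y) = T x + T y"
    and T_square: "x \<in> R \<Longrightarrow> T (x \<cdot> x) = T x \<cdot> x + x \<cdot> T x"
    and semiprime: "x \<in> R \<Longrightarrow> (\<And>y. y \<in> R \<Longrightarrow> x \<cdot> (y \<cdot> x) = 0) \<Longrightarrow> x = 0"
    and R_nonempty: "R \<noteq> {}"
begin

lemma R_zero [simp]: "0 \<in> R"
  using R_nonempty R_diff by fastforce

lemma R_minus [simp]: "x \<in> R \<Longrightarrow> - x \<in> R"
  using R_diff [of 0 x] by simp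

lemma R_add [simp]: "x \<in> R \<Longrightarrow> y \<in> R \<Longrightarrow> x + y \<in> R"
  using R_diff [of x "- y"] by simp

lemma zero_mult [simp]: "0 \<cdot> x = 0" "x \<cdot> 0 = 0"
  using add_left [of 0 0 x] add_right [of x 0 0] by simp_all

lemma minus_left: "(- x) \<cdot> y = - (x \<cdot> y)"
  using add_left [of x "- x" y] by (simp add: add_eq_0_iff)

lemma minus_right: "x \<cdot> (- y) = - (x \<cdot> y)"
  using add_right [of x y "- y"] by (simp add: add_eq_0_iff)

lemma diff_left: "(x - y) \<cdot> z = x \<cdot> z - y \<cdot> z"
  using add_left [of x "- y" z] by (simp add: minus_left)

lemma diff_right: "x \<cdot> (y - z) = x \<cdot> y - x \<cdot> z"
  using add_right [of x y "- z"] by (simp add: minus_right)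

lemmas ring_simps = add_left add_right diff_left diff_right minus_left minus_right assoc

lemma T_zero [simp]: "T 0 = 0"
  using T_add [of 0 0] by simp

lemma T_minus: "x \<in> R \<Longrightarrow> T (- x) = - T x"
  using T_add [of x "- x"] by (simp add: add_eq_0_iff)

lemma T_diff: "x \<in> R \<Longrightarrow> y \<in> R \<Longrightarrow> T (x - y) = T x - T y"
  using T_add [of x "- y"] by (simp add: T_minus)

lemma double_cancel: "x + x = y + y \<Longrightarrow> x = (y :: 'a)"
  by (metis scaleR_2 scaleR_cancel_left zero_neq_numeral)

lemma T_jordan:
  assumes "a \<in> R" "b \<in> R"
  shows "T (a \<cdot> b + b \<cdot> a) = T a \<cdot> b + a \<cdot> T b + T b \<cdot> a + b \<cdot> T a"
proof -
  have "a \<cdot> b + b \<cdot> a = (a + b) \<cdot> (a + b) - a \<cdot> a - b \<cdot> b"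
    by (simp add: ring_simps)
  then have "T (a \<cdot> b + b \<cdot> a) = T ((a + b) \<cdot> (a + b)) - T (a \<cdot> a) - T (b \<cdot> b)"
    using assms by (simp add: T_diff)
  then show ?thesis
    using assms by (simp add: T_square T_add) (simp add: ring_simps)
qed

text \<open>With Jordan product a o b = a b + b a, twice a b a equals a o (a o b) - (a a) o b, so
  \<open>T_jordan\<close> computes it; the factor 2 can be cancelled.\<close>

lemma T_triple:
  assumes "a \<in> R" "b \<in> R"
  shows "T (a \<cdot> (b \<cdot> a)) = T a \<cdot> (b \<cdot> a) + a \<cdot> (T b \<cdot> a) + a \<cdot> (b \<cdot> T a)"
proof (rule double_cancel)
  let ?w = "a \<cdot> b + b \<cdot> a" and ?q = "a \<cdot> a"
  have "a \<cdot> (b \<cdot> a) + a \<cdot> (b \<cdot> a) = (a \<cdot> ?w + ?w \<cdot> a) - (?q \<cdot> b + b \<cdot> ?q)"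
    by (simp add: ring_simps)
  moreover have "T (a \<cdot> (b \<cdot> a)) + T (a \<cdot> (b \<cdot> a)) = T (a \<cdot> (b \<cdot> a) + a \<cdot> (b \<cdot> a))"
    using assms by (simp add: T_add)
  ultimately have "T (a \<cdot> (b \<cdot> a)) + T (a \<cdot> (b \<cdot> a)) = T (a \<cdot> ?w + ?w \<cdot> a) - T (?q \<cdot> b + b \<cdot> ?q)"
    using assms by (simp add: T_diff)
  also have "\<dots> = (T a \<cdot> ?w + a \<cdot> T ?w + T ?w \<cdot> a + ?w \<cdot> T a)
      - (T ?q \<cdot> b + ?q \<cdot> T b + T b \<cdot> ?q + b \<cdot> T ?q)"
    using assms by (subst (1 2) T_jordan) simp_all
  finally show "T (a \<cdot> (b \<cdot> a)) + T (a \<cdot> (b \<cdot> a)) =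
      T a \<cdot> (b \<cdot> a) + a \<cdot> (T b \<cdot> a) + a \<cdot> (b \<cdot> T a) +
      (T a \<cdot> (b \<cdot> a) + a \<cdot> (T b \<cdot> a) + a \<cdot> (b \<cdot> T a))"
    using assms by (simp add: T_jordan T_square) (simp add: ring_simps)
qed

lemma T_triple_linear:
  assumes "a \<in> R" "b \<in> R" "c \<in> R"
  shows "T (a \<cdot> (b \<cdot> c) + c \<cdot> (b \<cdot> a)) = T a \<cdot> (b \<cdot> c) + a \<cdot> (T b \<cdot> c) + a \<cdot> (b \<cdot> T c)
    + T c \<cdot> (b \<cdot> a) + c \<cdot> (T b \<cdot> a) + c \<cdot> (b \<cdot> T a)"
proof -
  have "a \<cdot> (b \<cdot> c) + c \<cdot> (b \<cdot> a) = (a + c) \<cdot> (b \<cdot> (a + c)) - a \<cdot> (b \<cdot> a) - c \<cdot> (b \<cdot> c)"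
    by (simp add: ring_simps)
  then have "T (a \<cdot> (b \<cdot> c) + c \<cdot> (b \<cdot> a)) =
      T ((a + c) \<cdot> (b \<cdot> (a + c))) - T (a \<cdot> (b \<cdot> a)) - T (c \<cdot> (b \<cdot> c))"
    using assms by (simp add: T_diff)
  then show ?thesis
    using assms by (simp add: T_triple T_add) (simp add: ring_simps)
qed

section \<open>The defect of the product rule and its products with commutators\<close>

definition defect :: "'a \<Rightarrow> 'a \<Rightarrow> 'a"
  where "defect a b = T (a \<cdot> b) - T a \<cdot> b - a \<cdot> T b"

definition comm :: "'a \<Rightarrow> 'a \<Rightarrow> 'a"
  where "comm a b = a \<cdot> b - b \<cdot> a"

lemma R_defect [simp]: "a \<in> R \<Longrightarrow> b \<in> R \<Longrightarrow> defect a b \<in> R"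
  by (simp add: defect_def)

lemma R_comm [simp]: "a \<in> R \<Longrightarrow> b \<in> R \<Longrightarrow> comm a b \<in> R"
  by (simp add: comm_def)

lemma defect_swap: "a \<in> R \<Longrightarrow> b \<in> R \<Longrightarrow> defect b a = - defect a b"
  using T_jordan [of a b] by (simp add: defect_def T_add algebra_simps)

lemma defect_add_left: "a \<in> R \<Longrightarrow> c \<in> R \<Longrightarrow> b \<in> R \<Longrightarrow> defect (a + c) b = defect a b + defect c b"
  by (simp add: defect_def T_add ring_simps)

lemma defect_add_right: "a \<in> R \<Longrightarrow> c \<in> R \<Longrightarrow> b \<in> R \<Longrightarrow> defect b (a + c) = defect b a + defect b c"
  by (simp add: defect_def T_add ring_simps)

lemma comm_add: "comm (a + c) b = comm a b + comm c b" "comm b (a + c) = comm b a + comm b c"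
  by (simp_all add: comm_def ring_simps)

text \<open>Evaluate \<open>T\<close> at \<open>a b x b a + b a x a b\<close> in two ways, with the outer factors \<open>a\<close>, \<open>b\<close> and with the
  outer factors \<open>a b\<close>, \<open>b a\<close>.\<close>

lemma defect_comm_sum:
  assumes "a \<in> R" "b \<in> R" "x \<in> R"
  shows "defect a b \<cdot> (x \<cdot> comm a b) + comm a b \<cdot> (x \<cdot> defect a b) = 0"
proof -
  let ?W = "(a \<cdot> b) \<cdot> (x \<cdot> (b \<cdot> a)) + (b \<cdot> a) \<cdot> (x \<cdot> (a \<cdot> b))"
  let ?E = "T (a \<cdot> b) \<cdot> (x \<cdot> (b \<cdot> a)) + (a \<cdot> b) \<cdot> (T x \<cdot> (b \<cdot> a)) + (a \<cdot> b) \<cdot> (x \<cdot> T (b \<cdot> a))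
    + T (b \<cdot> a) \<cdot> (x \<cdot> (a \<cdot> b)) + (b \<cdot> a) \<cdot> (T x \<cdot> (a \<cdot> b)) + (b \<cdot> a) \<cdot> (x \<cdot> T (a \<cdot> b))"
  let ?B = "T b \<cdot> (x \<cdot> b) + b \<cdot> (T x \<cdot> b) + b \<cdot> (x \<cdot> T b)"
  let ?A = "T a \<cdot> (x \<cdot> a) + a \<cdot> (T x \<cdot> a) + a \<cdot> (x \<cdot> T a)"
  let ?F = "T a \<cdot> ((b \<cdot> (x \<cdot> b)) \<cdot> a) + a \<cdot> (?B \<cdot> a) + a \<cdot> ((b \<cdot> (x \<cdot> b)) \<cdot> T a)
    + (T b \<cdot> ((a \<cdot> (x \<cdot> a)) \<cdot> b) + b \<cdot> (?A \<cdot> b) + b \<cdot> ((a \<cdot> (x \<cdot> a)) \<cdot> T b))"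
  have "T ?W = T (a \<cdot> ((b \<cdot> (x \<cdot> b)) \<cdot> a) + b \<cdot> ((a \<cdot> (x \<cdot> a)) \<cdot> b))"
    by (simp add: assoc)
  also have "\<dots> = T (a \<cdot> ((b \<cdot> (x \<cdot> b)) \<cdot> a)) + T (b \<cdot> ((a \<cdot> (x \<cdot> a)) \<cdot> b))"
    using assms by (simp add: T_add)
  also have "\<dots> = ?F"
    using assms T_triple [of a "b \<cdot> (x \<cdot> b)"] T_triple [of b "a \<cdot> (x \<cdot> a)"]
      T_triple [of a x] T_triple [of b x] by simp
  finally have F: "T ?W = ?F" .
  have E: "T ?W = ?E"
    using assms by (intro T_triple_linear) simp_all
  have d: "defect b a = - defect a b"
    using assms(1,2) by (rule defect_swap)
  have "defect a b \<cdot> (x \<cdot> (b \<cdot> a)) + a \<cdot> (b \<cdot> (x \<cdot> defect b a)) + defect b a \<cdot> (x \<cdot> (a \<cdot> b))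
      + b \<cdot> (a \<cdot> (x \<cdot> defect a b)) = ?E - ?F"
    by (simp add: defect_def ring_simps algebra_simps)
  also have "\<dots> = 0"
    using E F by simp
  finally have "defect a b \<cdot> (x \<cdot> (b \<cdot> a)) + a \<cdot> (b \<cdot> (x \<cdot> defect b a)) + defect b a \<cdot> (x \<cdot> (a \<cdot> b))
      + b \<cdot> (a \<cdot> (x \<cdot> defect a b)) = 0" .
  moreover have "defect a b \<cdot> (x \<cdot> comm a b) + comm a b \<cdot> (x \<cdot> defect a b) =
      - (defect a b \<cdot> (x \<cdot> (b \<cdot> a)) + a \<cdot> (b \<cdot> (x \<cdot> defect b a)) + defect b a \<cdot> (x \<cdot> (a \<cdot> b))
      + b \<cdot> (a \<cdot> (x \<cdot> defect a b)))"
    unfolding d comm_def by (simp add: ring_simps)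
  ultimately show ?thesis
    by simp
qed

text \<open>For u = a x b, the product u y u changes sign under three uses of the hypothesis, with
  the middle factors y, x a y and x. So it equals its own negative.\<close>

lemma semiprime_sum:
  assumes "a \<in> R" "b \<in> R" and sum: "\<And>x. x \<in> R \<Longrightarrow> a \<cdot> (x \<cdot> b) + b \<cdot> (x \<cdot> a) = 0"
    and "x \<in> R"
  shows "a \<cdot> (x \<cdot> b) = 0"
proof (rule semiprime)
  fix y assume y: "y \<in> R"
  have s: "a \<cdot> (z \<cdot> b) = - (b \<cdot> (z \<cdot> a))" if "z \<in> R" for z
    using sum [OF that] by (simp add: add_eq_0_iff)
  let ?u = "a \<cdot> (x \<cdot> b)"
  have "?u \<cdot> (y \<cdot> ?u) = a \<cdot> (x \<cdot> (b \<cdot> (y \<cdot> a) \<cdot> (x \<cdot> b)))"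
    by (simp add: assoc)
  also have "b \<cdot> (y \<cdot> a) = - (a \<cdot> (y \<cdot> b))"
    using s [OF y] by simp
  also have "a \<cdot> (x \<cdot> (- (a \<cdot> (y \<cdot> b)) \<cdot> (x \<cdot> b))) = - (a \<cdot> ((x \<cdot> (a \<cdot> y)) \<cdot> b) \<cdot> (x \<cdot> b))"
    by (simp add: assoc minus_left minus_right)
  also have "\<dots> = (b \<cdot> (x \<cdot> a)) \<cdot> (y \<cdot> (a \<cdot> (x \<cdot> b)))"
    using assms y by (subst s) (simp_all add: assoc minus_left)
  also have "b \<cdot> (x \<cdot> a) = - ?u"
    using s [OF \<open>x \<in> R\<close>] by simp
  finally have "?u \<cdot> (y \<cdot> ?u) + ?u \<cdot> (y \<cdot> ?u) = 0 + 0"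
    by (simp add: minus_left eq_neg_iff_add_eq_0)
  then show "?u \<cdot> (y \<cdot> ?u) = 0"
    by (rule double_cancel)
qed (use assms in simp)

lemma defect_comm_same:
  assumes "a \<in> R" "b \<in> R" "x \<in> R"
  shows "defect a b \<cdot> (x \<cdot> comm a b) = 0" "comm a b \<cdot> (x \<cdot> defect a b) = 0"
proof -
  show "defect a b \<cdot> (x \<cdot> comm a b) = 0"
    by (rule semiprime_sum) (simp_all add: assms defect_comm_sum)
  show "comm a b \<cdot> (x \<cdot> defect a b) = 0"
  proof (rule semiprime_sum)
    show "comm a b \<cdot> (y \<cdot> defect a b) + defect a b \<cdot> (y \<cdot> comm a b) = 0" if "y \<in> R" for y
      using defect_comm_sum [OF assms(1,2) that] by (simp only: add.commute)
  qed (simp_all add: assms)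
qed

text \<open>Linearizing \<open>defect_comm_same\<close> in \<open>a\<close> exchanges
  \<open>a\<close> and \<open>c\<close> up to sign. Inserting this into one factor of u y u puts
  \<open>comm c b\<close>, y, \<open>defect c b\<close> side by side, a product known to
  vanish.\<close>

lemma defect_comm_left:
  assumes "a \<in> R" "b \<in> R" "c \<in> R" "x \<in> R"
  shows "defect a b \<cdot> (x \<cdot> comm c b) = 0"
proof (rule semiprime)
  fix y assume y: "y \<in> R"
  have eq: "defect a b \<cdot> (x \<cdot> comm c b) = - (defect c b \<cdot> (x \<cdot> comm a b))"
    using defect_comm_same(1) [of "a + c" b x] defect_comm_same(1) [of a b x]
      defect_comm_same(1) [of c b x] assms
    by (simp add: defect_add_left comm_add ring_simps add_eq_0_iff)
  have "(defect a b \<cdot> (x \<cdot> comm c b)) \<cdot> (y \<cdot> (defect a b \<cdot> (x \<cdot> comm c b))) = (defect a b \<cdot> (x \<cdot> comm c b)) \<cdot> (y \<cdot> - (defect c b \<cdot> (x \<cdot> comm a b)))"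
    by (subst (2) eq) (rule refl)
  also have "\<dots> =
      - (defect a b \<cdot> (x \<cdot> ((comm c b \<cdot> (y \<cdot> defect c b)) \<cdot> (x \<cdot> comm a b))))"
    by (simp add: ring_simps)
  also have "\<dots> = 0"
    using assms y by (simp add: defect_comm_same)
  finally show "(defect a b \<cdot> (x \<cdot> comm c b)) \<cdot> (y \<cdot> (defect a b \<cdot> (x \<cdot> comm c b))) = 0" .
qed (use assms in simp)

lemma comm_defect_left:
  assumes "a \<in> R" "b \<in> R" "c \<in> R" "x \<in> R"
  shows "comm c b \<cdot> (x \<cdot> defect a b) = 0"
proof (rule semiprime)
  fix y assume y: "y \<in> R"
  have "(comm c b \<cdot> (x \<cdot> defect a b)) \<cdot> (y \<cdot> (comm c b \<cdot> (x \<cdot> defect a b))) =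
      comm c b \<cdot> (x \<cdot> ((defect a b \<cdot> (y \<cdot> comm c b)) \<cdot> (x \<cdot> defect a b)))"
    by (simp add: assoc)
  then show "(comm c b \<cdot> (x \<cdot> defect a b)) \<cdot> (y \<cdot> (comm c b \<cdot> (x \<cdot> defect a b))) = 0"
    using assms y by (simp add: defect_comm_left)
qed (use assms in simp)

text \<open>The same linearization, now in the second argument; the vanishing middle factor is
  supplied by \<open>comm_defect_left\<close>.\<close>

lemma defect_comm:
  assumes "a \<in> R" "b \<in> R" "c \<in> R" "d \<in> R" "x \<in> R"
  shows "defect a b \<cdot> (x \<cdot> comm c d) = 0"
proof (rule semiprime)
  fix y assume y: "y \<in> R"
  have eq: "defect a b \<cdot> (x \<cdot> comm c d) = - (defect a d \<cdot> (x \<cdot> comm c b))"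
    using defect_comm_left [of a "b + d" c x] defect_comm_left [of a b c x]
      defect_comm_left [of a d c x] assms
    by (simp add: defect_add_right comm_add ring_simps add_eq_0_iff)
  have "(defect a b \<cdot> (x \<cdot> comm c d)) \<cdot> (y \<cdot> (defect a b \<cdot> (x \<cdot> comm c d))) = (defect a b \<cdot> (x \<cdot> comm c d)) \<cdot> (y \<cdot> - (defect a d \<cdot> (x \<cdot> comm c b)))"
    by (subst (2) eq) (rule refl)
  also have "\<dots> =
      - (defect a b \<cdot> (x \<cdot> ((comm c d \<cdot> (y \<cdot> defect a d)) \<cdot> (x \<cdot> comm c b))))"
    by (simp add: ring_simps)
  also have "\<dots> = 0"
    using assms y by (simp add: comm_defect_left)
  finally show "(defect a b \<cdot> (x \<cdot> comm c d)) \<cdot> (y \<cdot> (defect a b \<cdot> (x \<cdot> comm c d))) = 0" .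
qed (use assms in simp)

text \<open>\<open>defect_comm\<close> also holds when an entry of the commutator is the defect
  itself. Expanding the left factor of \<open>comm z r\<close>, x, \<open>comm z r\<close> therefore
  leaves only vanishing terms.\<close>

lemma defect_central:
  assumes "a \<in> R" "b \<in> R" "r \<in> R"
  shows "defect a b \<cdot> r = r \<cdot> defect a b"
proof -
  let ?z = "defect a b"
  have "comm ?z r = 0"
  proof (rule semiprime)
    fix x assume x: "x \<in> R"
    have "comm ?z r \<cdot> (x \<cdot> comm ?z r) = ?z \<cdot> ((r \<cdot> x) \<cdot> comm ?z r) - r \<cdot> (?z \<cdot> (x \<cdot> comm ?z r))"
      by (simp add: comm_def [of ?z r] ring_simps)
    then show "comm ?z r \<cdot> (x \<cdot> comm ?z r) = 0"
      using assms x defect_comm [of a b ?z r] by simp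
  qed (use assms in simp)
  then show ?thesis by (simp add: comm_def)
qed

lemma defect_mult_comm:
  assumes "a \<in> R" "b \<in> R" "c \<in> R" "d \<in> R"
  shows "defect a b \<cdot> comm c d = 0"
proof (rule semiprime)
  fix y assume y: "y \<in> R"
  have "(defect a b \<cdot> comm c d) \<cdot> (y \<cdot> (defect a b \<cdot> comm c d)) =
      defect a b \<cdot> ((comm c d \<cdot> (y \<cdot> defect a b)) \<cdot> comm c d)"
    by (simp add: assoc)
  then show "(defect a b \<cdot> comm c d) \<cdot> (y \<cdot> (defect a b \<cdot> comm c d)) = 0"
    using assms y by (simp add: defect_comm)
qed (use assms in simp)

text \<open>A central nilpotent element of a semiprime ring is zero, so z^3 = 0 suffices. Twice
  \<open>z\<close> is \<open>T w\<close> minus commutators annihilated by \<open>z\<close>, hence 2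
  z^2 = z T w; applying \<open>T\<close> to z w + w z = 0 and multiplying by \<open>z\<close> gives
  z^2 T w = 0.\<close>

lemma defect_zero:
  assumes "a \<in> R" "b \<in> R"
  shows "defect a b = 0"
proof -
  define z where "z = defect a b"
  define w where "w = comm a b"
  have R [simp]: "z \<in> R" "w \<in> R"
    using assms by (simp_all add: z_def w_def)
  have central: "z \<cdot> r = r \<cdot> z" if "r \<in> R" for r
    using assms that by (simp add: z_def defect_central)
  have zc: "z \<cdot> comm c d = 0" if "c \<in> R" "d \<in> R" for c d
    using assms that by (simp add: z_def defect_mult_comm)
  have zw: "z \<cdot> w = 0"
    using assms zc by (simp add: w_def)
  have wz: "w \<cdot> z = 0"
    using zw central [of w] by simp
  have "z + z = T w - comm (T a) b - comm a (T b)"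
    using assms defect_swap [of a b] unfolding z_def w_def
    by (simp add: defect_def comm_def T_diff algebra_simps)
  then have "z \<cdot> (z + z) = z \<cdot> T w - z \<cdot> comm (T a) b - z \<cdot> comm a (T b)"
    by (simp add: diff_right)
  then have zz: "z \<cdot> z + z \<cdot> z = z \<cdot> T w"
    using assms by (simp add: zc add_right)
  have "0 = z \<cdot> (T z \<cdot> w + z \<cdot> T w + T w \<cdot> z + w \<cdot> T z)"
    using T_jordan [of z w] by (simp add: zw wz)
  also have "\<dots> = z \<cdot> T z \<cdot> w + z \<cdot> (z \<cdot> T w + T w \<cdot> z) + z \<cdot> w \<cdot> T z"
    by (simp add: ring_simps)
  also have "z \<cdot> T z \<cdot> w = T z \<cdot> (z \<cdot> w)"
    using central [of "T z"] by (simp flip: assoc)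
  also have "T w \<cdot> z = z \<cdot> T w"
    using central [of "T w"] by simp
  finally have "z \<cdot> (z \<cdot> T w) + z \<cdot> (z \<cdot> T w) = 0 + 0"
    by (simp add: zw add_right)
  then have "z \<cdot> (z \<cdot> T w) = 0"
    by (rule double_cancel)
  then have "z \<cdot> (z \<cdot> z) + z \<cdot> (z \<cdot> z) = 0 + 0"
    by (simp flip: zz add: add_right)
  then have zzz: "z \<cdot> (z \<cdot> z) = 0"
    by (rule double_cancel)
  have zz0: "z \<cdot> z = 0"
  proof (rule semiprime)
    fix y assume "y \<in> R"
    have "z \<cdot> z \<cdot> (y \<cdot> (z \<cdot> z)) = z \<cdot> (z \<cdot> (y \<cdot> z)) \<cdot> z"
      by (simp add: assoc)
    also have "y \<cdot> z = z \<cdot> y"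
      using central [OF \<open>y \<in> R\<close>] by simp
    also have "z \<cdot> (z \<cdot> (z \<cdot> y)) = z \<cdot> (z \<cdot> z) \<cdot> y"
      by (simp add: assoc)
    finally show "z \<cdot> z \<cdot> (y \<cdot> (z \<cdot> z)) = 0"
      by (simp add: zzz)
  qed simp
  have "z = 0"
  proof (rule semiprime)
    fix y assume "y \<in> R"
    have "z \<cdot> (y \<cdot> z) = z \<cdot> (z \<cdot> y)"
      by (simp only: central [OF \<open>y \<in> R\<close>])
    also have "\<dots> = z \<cdot> z \<cdot> y"
      by (simp only: assoc)
    finally have "z \<cdot> (y \<cdot> z) = z \<cdot> z \<cdot> y" .
    then show "z \<cdot> (y \<cdot> z) = 0"
      by (simp add: zz0)
  qed simp
  then show ?thesis
    by (simp add: z_def)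
qed

theorem derivation: "a \<in> R \<Longrightarrow> b \<in> R \<Longrightarrow> T (a \<cdot> b) = T a \<cdot> b + a \<cdot> T b"
  using defect_zero [of a b] by (simp add: defect_def algebra_simps)

end

section \<open>The Jordan identity\<close>

text \<open>The defect \<open>T(a\<^sup>2) - a T(a) - T(a) a\<close> commutes with the spectral projections \<open>h\<close> of \<open>a\<close>, and its
  corner at \<open>h\<close> depends quadratically on \<open>h (a - t)\<close>, for every scalar \<open>t\<close>.\<close>

lemma local_map_jordan:
  assumes T: "local_map M T" and T': "local_map M T'"
    and adj: "\<And>x. x \<in> M \<Longrightarrow> self_adjoint x \<Longrightarrow> is_adjoint (T x) (T' x)"
    and T_id: "T id_blinfun = 0" and a: "a \<in> M" "self_adjoint a"
  shows "T (a \<odot> a) = T a \<odot> a + a \<odot> T a"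
proof -
  interpret T: local_map M T by fact
  interpret T': local_map M T' by fact
  let ?S = "commutant {a}"
  note S = bicommutant_singleton [OF T.vn a(1)]
  have commS: "x \<odot> y = y \<odot> x" if "x \<in> commutant ?S" "y \<in> commutant ?S" for x y
    using that S(2) by (auto simp: commutant_def)
  \<comment> \<open>Off the diagonal \<open>T\<close> acts as commutation with the fixed operator e
    T(e) (1 - e). The term with \<open>b\<close> on the left is \<open>off_diag\<close> for
    \<open>T\<close>, the one on the right is \<open>off_diag\<close> for \<open>T'\<close> after
    taking adjoints; T(1) = 0 links T(1 - e) with T(e).\<close>
  have off: "e \<odot> T b \<odot> (id_blinfun - e) = b \<odot> (e \<odot> T e \<odot> (id_blinfun - e)) - (e \<odot> T e \<odot> (id_blinfun - e)) \<odot> b"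
    if e: "projection e" "e \<in> M" and b: "b \<in> M" "self_adjoint b" and eb: "e \<odot> b = b \<odot> e" for e b
  proof -
    define f where "f = id_blinfun - e"
    have f: "projection f" "f \<in> M" "e \<odot> f = 0" "f \<odot> e = 0" "f \<odot> b = b \<odot> f"
      using e eb T.closed by (simp_all add: f_def compose_simps)
    have mem: "e \<odot> b \<in> M" "self_adjoint (e \<odot> b)" "f \<odot> b \<in> M" "self_adjoint (f \<odot> b)"
      using e b f eb T.closed by (auto intro: self_adjoint_compose)
    have left: "e \<odot> T (e \<odot> b) \<odot> f = b \<odot> (e \<odot> T e \<odot> f)"
      by (rule T.off_diag) (fact b e f eb)+
    have "f \<odot> T' (f \<odot> b) \<odot> e = b \<odot> (f \<odot> T' f \<odot> e)"
      by (rule T'.off_diag) (fact b e f eb)+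
    moreover have "is_adjoint (e \<odot> T (f \<odot> b) \<odot> f) (f \<odot> (T' (f \<odot> b) \<odot> e))"
      using e f mem by (intro is_adjoint_compose adj) (simp_all flip: self_adjoint_def)
    moreover have "is_adjoint ((e \<odot> T f \<odot> f) \<odot> b) (b \<odot> (f \<odot> (T' f \<odot> e)))"
      using e f b by (intro is_adjoint_compose adj) (simp_all flip: self_adjoint_def)
    ultimately have right: "e \<odot> T (f \<odot> b) \<odot> f = (e \<odot> T f \<odot> f) \<odot> b"
      by (metis compose_assoc is_adjoint_unique_left)
    have "T f = - T e"
      using T.diff [of id_blinfun e] e T.closed T_id by (simp add: f_def)
    have "b = e \<odot> b + f \<odot> b"
      by (simp add: f_def compose_simps)
    then have "T b = T (e \<odot> b) + T (f \<odot> b)"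
      using T.add [OF mem] by simp
    then have "e \<odot> T b \<odot> f = e \<odot> T (e \<odot> b) \<odot> f + e \<odot> T (f \<odot> b) \<odot> f"
      by (simp add: compose_simps)
    then show ?thesis
      unfolding left right \<open>T f = - T e\<close> f_def [symmetric]
      by (simp only: compose_minus_left compose_minus_right diff_conv_add_uminus)
  qed
  have corner: "h \<odot> T b \<odot> h = h \<odot> T (h \<odot> b) \<odot> h"
    if h: "projection h" "h \<in> M" and b: "b \<in> M" "self_adjoint b" and hb: "h \<odot> b = b \<odot> h" for h b
  proof -
    have mem: "h \<odot> b \<in> M" "self_adjoint (h \<odot> b)"
      using h b hb by (auto intro: T.closed self_adjoint_compose)
    have "h \<odot> T (b - h \<odot> b) \<odot> h = 0"
      using h b hb mem
      by (intro T.local_diag T.closed self_adjoint_diff)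
        (simp_all add: compose_simps compose_left_commute [OF hb] projection_idem_left)
    then show ?thesis
      by (simp add: T.diff b mem compose_diff_left compose_diff_right)
  qed
  define y where "y = T (a \<odot> a) - a \<odot> T a - T a \<odot> a"
  have aa: "a \<odot> a \<in> M" "self_adjoint (a \<odot> a)"
    using a T.closed by auto
  \<comment> \<open>Commutation with \<open>\<tau>\<close> is a derivation, so the off-diagonal
    contributions of a and a^2 cancel in \<open>y\<close>.\<close>
  have block: "h \<odot> y = h \<odot> y \<odot> h" if h: "projection h" "h \<in> commutant ?S" for h
  proof -
    have hM: "h \<in> M" using h S(4) by auto
    have ha: "h \<odot> a = a \<odot> h" by (rule commS [OF h(2) S(3)])
    let ?f = "id_blinfun - h"
    have fa: "?f \<odot> a = a \<odot> ?f" using ha by (simp add: compose_simps)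
    define \<tau> where "\<tau> = h \<odot> T h \<odot> ?f"
    have 1: "h \<odot> T a \<odot> ?f = a \<odot> \<tau> - \<tau> \<odot> a"
      unfolding \<tau>_def by (rule off [OF h(1) hM a ha])
    have 2: "h \<odot> T (a \<odot> a) \<odot> ?f = (a \<odot> a) \<odot> \<tau> - \<tau> \<odot> (a \<odot> a)"
      unfolding \<tau>_def
      by (rule off [OF h(1) hM aa]) (simp add: compose_left_commute [OF ha] ha compose_assoc)
    have "h \<odot> y \<odot> ?f = h \<odot> T (a \<odot> a) \<odot> ?f - h \<odot> a \<odot> T a \<odot> ?f - h \<odot> T a \<odot> (a \<odot> ?f)"
      by (simp add: y_def compose_diff_left compose_diff_right compose_assoc)
    also have "\<dots> = h \<odot> T (a \<odot> a) \<odot> ?f - a \<odot> (h \<odot> T a \<odot> ?f) - (h \<odot> T a \<odot> ?f) \<odot> a"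
      unfolding ha fa [symmetric] by (simp only: compose_assoc)
    also have "\<dots> = 0"
      unfolding 1 2 by (simp add: compose_simps)
    finally show ?thesis
      by (simp add: compose_diff_right)
  qed
  have diag: "h \<odot> T h \<odot> h = 0" if "projection h" "h \<in> commutant ?S" for h
    using corner [of h id_blinfun] that S(4) T.closed(5) by (auto simp: T_id)
  have "blinfun_apply y \<xi> = 0" for \<xi>
  proof (rule spectral_localization [OF S(1,2,3) a(2)])
    fix h and t :: real
    assume h: "projection h" "h \<in> commutant ?S" and "h \<odot> (a - t *\<^sub>R id_blinfun) = 0"
    then have ha1: "h \<odot> a = t *\<^sub>R h"
      by (simp add: compose_simps)
    have "h \<odot> (a \<odot> a) = t *\<^sub>R (h \<odot> a)"
      by (simp only: compose_assoc [symmetric] ha1 compose_scaleR_left)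
    then have ha: "h \<odot> a = t *\<^sub>R h" "h \<odot> (a \<odot> a) = (t * t) *\<^sub>R h"
      by (simp_all add: ha1)
    have ah: "a \<odot> h = t *\<^sub>R h" "h \<odot> a = a \<odot> h" "h \<odot> (a \<odot> a) = a \<odot> a \<odot> h"
      using commS [OF h(2) S(3)] ha(1) commS [OF h(2), of "a \<odot> a"] S(3)
      by (simp_all add: commutant_subalgebra(3))
    have hM: "h \<in> M" "self_adjoint h" using h S(4) by auto
    have Ta: "h \<odot> T a \<odot> h = 0" "h \<odot> T (a \<odot> a) \<odot> h = 0"
      using corner [OF h(1) hM(1) a ah(2)] corner [OF h(1) hM(1) aa ah(3)] diag [OF h]
      by (simp_all only: ha T.scale [OF hM] compose_scaleR_left compose_scaleR_right) simp_all
    have "h \<odot> y = h \<odot> T (a \<odot> a) \<odot> h - h \<odot> a \<odot> T a \<odot> h - h \<odot> T a \<odot> (a \<odot> h)"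
      by (subst block [OF h]) (simp add: y_def compose_diff_left compose_diff_right compose_assoc)
    also have "\<dots> = 0"
      by (simp only: ha(1) ah(1) Ta compose_scaleR_left compose_scaleR_right) simp
    finally show "blinfun_apply h (blinfun_apply y \<xi>) = 0"
      by (simp add: compose_eq_apply)
  next
    fix h :: "nat \<Rightarrow> 'a \<Rightarrow>\<^sub>L 'a" and c l :: "nat \<Rightarrow> real"
    assume h: "\<And>k. projection (h k)" "\<And>k. h k \<in> commutant ?S" "\<And>j k. j \<noteq> k \<Longrightarrow> h j \<odot> h k = 0"
      and c: "\<And>k. 1 \<le> c k"
      and small: "\<And>k. norm (c k *\<^sub>R (h k \<odot> (a - l k *\<^sub>R id_blinfun))) \<le> (1/2) ^ k"
    obtain x where x: "x \<in> commutant ?S" "self_adjoint x"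
      "\<And>k. h k \<odot> x = c k *\<^sub>R (h k \<odot> (a - l k *\<^sub>R id_blinfun))"
      using orthogonal_series [OF S(2,3) a(2) h small] by blast
    have xM: "x \<in> M" "x \<odot> x \<in> M" "self_adjoint (x \<odot> x)"
      using x S(4) T.closed(3) by auto
    define z where "z = T (x \<odot> x) - x \<odot> T x - T x \<odot> x"
    have "c k * norm (blinfun_apply (h k) (blinfun_apply y \<xi>)) \<le> norm z * norm \<xi>" for k
    proof -
      note hk = h(1,2) [of k]
      let ?h = "h k" and ?c = "c k" and ?l = "l k"
      have hM: "?h \<in> M" "self_adjoint ?h" using hk S(4) by auto
      have comm: "a \<odot> ?h = ?h \<odot> a" "x \<odot> ?h = ?h \<odot> x" "x \<odot> a = a \<odot> x"
        using commS hk x(1) S(3) by auto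
      have hx: "?h \<odot> x = ?c *\<^sub>R (?h \<odot> a) - (?c * ?l) *\<^sub>R ?h"
        using x(3) [of k] by (simp add: compose_simps scaleR_diff_right)
      have "?h \<odot> (x \<odot> x) = (?h \<odot> x) \<odot> (?h \<odot> x)"
        by (simp only: compose_assoc compose_left_commute [OF comm(2)] projection_idem_left [OF hk(1)])
      also have "\<dots> = (?c * ?c) *\<^sub>R (?h \<odot> (a \<odot> a)) - (2 * (?c * ?c) * ?l) *\<^sub>R (?h \<odot> a) + (?c * ?l * (?c * ?l)) *\<^sub>R ?h"
        unfolding hx
        by (simp add: compose_simps comm compose_left_commute [OF comm(1)] projection_idem_left [OF hk(1)] hk(1)
            algebra_simps flip: scaleR_2)
      finally have hxx: "?h \<odot> (x \<odot> x) = \<dots>" .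
      have sa: "?h \<odot> a \<in> M" "self_adjoint (?h \<odot> a)" "?h \<odot> (a \<odot> a) \<in> M" "self_adjoint (?h \<odot> (a \<odot> a))"
        using hM a aa comm(1) by (auto intro!: T.closed self_adjoint_compose simp: compose_assoc compose_left_commute [OF comm(1)])
      have corners: "?h \<odot> T a \<odot> ?h = ?h \<odot> T (?h \<odot> a) \<odot> ?h"
        "?h \<odot> T (a \<odot> a) \<odot> ?h = ?h \<odot> T (?h \<odot> (a \<odot> a)) \<odot> ?h"
        "?h \<odot> T x \<odot> ?h = ?h \<odot> T (?h \<odot> x) \<odot> ?h"
        "?h \<odot> T (x \<odot> x) \<odot> ?h = ?h \<odot> T (?h \<odot> (x \<odot> x)) \<odot> ?h"
        by (rule corner; use hk hM a aa x(1,2) xM comm in \<open>simp add: compose_assoc compose_left_commute [OF comm(1)] compose_left_commute [OF comm(2)]\<close>)+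
      define W where "W = ?h \<odot> T a \<odot> ?h"
      have Tx: "?h \<odot> T x \<odot> ?h = ?c *\<^sub>R W"
        unfolding corners(3) hx W_def corners(1)
        using diag [OF hk] hM sa
        by (simp add: T.diff T.scale T.closed compose_simps)
      \<comment> \<open>The shift by \<open>l k\<close> contributes a multiple of
        \<open>h k\<close>, whose corner under \<open>T\<close> vanishes by \<open>diag\<close>, and
        a multiple of \<open>W\<close>, which cancels against the cross terms when the defect
        \<open>z\<close> is compressed.\<close>
      have Txx: "?h \<odot> T (x \<odot> x) \<odot> ?h = (?c * ?c) *\<^sub>R (?h \<odot> T (a \<odot> a) \<odot> ?h) - (2 * (?c * ?c) * ?l) *\<^sub>R W"
        unfolding corners(4) hxx W_def corners(1,2)
        using diag [OF hk] hM sa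
        by (simp add: T.add T.diff T.scale T.closed compose_simps)
      have hW: "?h \<odot> W = W" "W \<odot> ?h = W"
        using hk by (simp_all add: W_def compose_assoc projection_idem_left)
      have expand: "?h \<odot> (T (b \<odot> b) - b \<odot> T b - T b \<odot> b) \<odot> ?h =
          ?h \<odot> T (b \<odot> b) \<odot> ?h - (?h \<odot> b) \<odot> (?h \<odot> T b \<odot> ?h) - (?h \<odot> T b \<odot> ?h) \<odot> (?h \<odot> b)"
        if "b \<odot> ?h = ?h \<odot> b" for b
        using hk that
        by (simp add: compose_simps compose_left_commute [OF that] projection_idem_left)
      have "?h \<odot> z \<odot> ?h = (?c * ?c) *\<^sub>R (?h \<odot> y \<odot> ?h)"
        unfolding z_def y_def expand [OF comm(1)] expand [OF comm(2)] Tx Txx W_def [symmetric] hx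
        by (simp add: compose_simps hW algebra_simps) (simp flip: scaleR_add_left add: algebra_simps)
      then have "(?c * ?c) *\<^sub>R (?h \<odot> y) = ?h \<odot> (z \<odot> ?h)"
        using block [OF hk] by (simp add: compose_assoc)
      moreover have "norm (?h \<odot> (z \<odot> ?h)) \<le> norm z"
        using norm_projection_compose_le [OF hk(1), of "z \<odot> ?h"] norm_compose_projection_le [OF hk(1), of z]
        by simp
      ultimately have "norm (blinfun_apply ((?c * ?c) *\<^sub>R (?h \<odot> y)) \<xi>) \<le> norm z * norm \<xi>"
        by (metis norm_blinfun mult_right_mono norm_ge_zero order_trans)
      \<comment> \<open>The defect scales with the square of \<open>c k\<close>, while the
        localization lemma asks for a bound on the first power; \<open>c k\<close> >= 1 closes the
        gap.\<close>
      moreover have "?c \<le> ?c * ?c"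
        using c [of k] by simp
      then have "?c * norm (blinfun_apply ?h (blinfun_apply y \<xi>)) \<le> ?c * ?c * norm (blinfun_apply ?h (blinfun_apply y \<xi>))"
        by (rule mult_right_mono) simp
      ultimately show ?thesis
        by (simp add: blinfun.scaleR_left)
    qed
    then show "\<exists>K. \<forall>k. c k * norm (blinfun_apply (h k) (blinfun_apply y \<xi>)) \<le> K"
      by blast
  qed
  then have "y = 0"
    by (intro blinfun_eqI) simp
  then show ?thesis
    by (simp add: y_def algebra_simps)
qed

section \<open>Vector states and the main theorem\<close>

text \<open>Testing on x + y and on x + \<i> y gives, by complex linearity of \<open>B\<close>, two
  independent equations for the two mixed inner products. It turns statements about vector states
  into operator identities.\<close>

lemma polarization_zero:
  assumes B: "B \<in> bounded_operators" and zero: "\<And>x. cinner (blinfun_apply B x) x = 0"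
  shows "B = (0 :: 'h :: complex_hilbert_space \<Rightarrow>\<^sub>L 'h)"
proof (rule blinfun_eqI)
  have BC: "blinfun_apply B (c *\<^sub>C x) = c *\<^sub>C blinfun_apply B x" for c x
    using B by (simp add: bounded_operators_def)
  fix x
  have "cinner (blinfun_apply B x) y = 0" for y
  proof -
    have "cinner (blinfun_apply B x) y + cinner (blinfun_apply B y) x = 0"
      using zero [of "x + y"] zero [of x] zero [of y]
      by (simp add: blinfun_simps cinner_simps add.commute)
    moreover have "- \<i> * cinner (blinfun_apply B x) y + \<i> * cinner (blinfun_apply B y) x = 0"
      using zero [of "x + \<i> *\<^sub>C y"] zero [of x] zero [of y] by (simp add: blinfun_simps cinner_simps BC)
    ultimately show ?thesis
      by (simp add: algebra_simps add_eq_0_iff)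
  qed
  then show "blinfun_apply B x = blinfun_apply 0 x"
    using cinner_self_eq_0 [of "blinfun_apply B x"] by simp
qed

lemma vector_state_normal:
  fixes M :: "('h :: complex_hilbert_space \<Rightarrow>\<^sub>L 'h) set"
  assumes M: "von_neumann_algebra M" and \<xi>: "norm \<xi> = 1"
  shows "(\<lambda>a. cinner (blinfun_apply a \<xi>) \<xi>) \<in> normal_states M"
  unfolding normal_states_def
proof (intro CollectI conjI)
  let ?\<phi> = "\<lambda>a :: 'h \<Rightarrow>\<^sub>L 'h. cinner (blinfun_apply a \<xi>) \<xi>"
  let ?\<xi> = "\<lambda>n :: nat. if n = 0 then \<xi> else 0"
  have "(\<lambda>n. (norm (?\<xi> n))\<^sup>2) sums (norm \<xi>)\<^sup>2"
    using sums_single [of 0 "\<lambda>_. (norm \<xi>)\<^sup>2"] by (rule sums_cong [THEN iffD1, rotated]) simp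
  moreover have "(\<lambda>n. cinner (blinfun_apply a (?\<xi> n)) (?\<xi> n)) sums ?\<phi> a" for a
    using sums_single [of 0 "\<lambda>_. ?\<phi> a"] by (rule sums_cong [THEN iffD1, rotated]) simp
  ultimately show "?\<phi> \<in> predual M"
    unfolding predual_def mem_Collect_eq by (intro exI [of _ ?\<xi>] conjI ballI sums_summable)
  show "positive_functional M ?\<phi>"
    unfolding positive_functional_def
  proof (intro ballI impI)
    fix a b :: "'h \<Rightarrow>\<^sub>L 'h" assume "is_adjoint a b"
    then have "cinner (blinfun_apply a \<xi>) (blinfun_apply a \<xi>) = cinner (blinfun_apply (b o\<^sub>L a) \<xi>) \<xi>"
      using is_adjoint_sym [of a b] by (simp add: is_adjoint_def)
    then have "?\<phi> (b o\<^sub>L a) = of_real ((norm (blinfun_apply a \<xi>))\<^sup>2)"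
      by (simp add: cinner_self)
    then show "?\<phi> (b o\<^sub>L a) \<in> \<real> \<and> 0 \<le> Re (?\<phi> (b o\<^sub>L a))"
      by simp
  qed
  \<comment> \<open>The supremum is attained at the identity.\<close>
  have "(SUP a \<in> {a \<in> M. norm a \<le> 1}. cmod (?\<phi> a)) = 1"
  proof (rule cSup_eq_maximum)
    have "cmod (?\<phi> id_blinfun) = 1"
      using \<xi> by (simp add: cinner_self)
    then show "1 \<in> (\<lambda>a. cmod (?\<phi> a)) ` {a \<in> M. norm a \<le> 1}"
      using von_neumann_algebra_closed(5) [OF M] norm_blinfun_id_le by force
    fix t assume "t \<in> (\<lambda>a. cmod (?\<phi> a)) ` {a \<in> M. norm a \<le> 1}"
    then obtain a where "norm a \<le> 1" "t = cmod (?\<phi> a)" by auto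
    then show "t \<le> 1"
      using norm_cinner_le [of "blinfun_apply a \<xi>" \<xi>] norm_blinfun [of a \<xi>] \<xi> by simp
  qed
  then show "functional_norm M ?\<phi> = 1"
    by (simp add: functional_norm_def)
qed

text \<open>States give unit vectors only. Both sides scale by the square of the norm, so the
  derivation for the normalized vector serves; at the zero vector any derivation does.\<close>

lemma weak_star_local_derivation_vector:
  assumes M: "von_neumann_algebra M" and T: "weak_star_local_derivation_on M T" and a: "a \<in> M"
  obtains D where "derivation_on M D" "cinner (blinfun_apply (T a) \<xi>) \<xi> = cinner (blinfun_apply (D a) \<xi>) \<xi>"
proof (cases "\<xi> = 0")
  case True
  obtain D where "derivation_on M D"
  proof
    show "derivation_on M (\<lambda>_. 0)"
      using von_neumann_algebra_closed(2) [OF M a a]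
      by (auto simp: derivation_on_def linear_map_on_def intro!: blinfun_eqI)
  qed
  then show thesis using that True by simp
next
  case False
  define r where "r = norm \<xi>"
  define \<eta> where "\<eta> = (1 / r) *\<^sub>R \<xi>"
  have \<eta>: "norm \<eta> = 1" "\<xi> = r *\<^sub>R \<eta>"
    using False by (simp_all add: \<eta>_def r_def)
  have "\<forall>\<phi> \<in> normal_states M. \<exists>D. derivation_on M D \<and> \<phi> (T a) = \<phi> (D a)"
    using T a by (simp add: weak_star_local_derivation_on_def)
  from bspec [OF this vector_state_normal [OF M \<eta>(1)]]
  obtain D where D: "derivation_on M D" "cinner (blinfun_apply (T a) \<eta>) \<eta> = cinner (blinfun_apply (D a) \<eta>) \<eta>"
    by blast
  show thesis
  proof (rule that [OF D(1)])
    show "cinner (blinfun_apply (T a) \<xi>) \<xi> = cinner (blinfun_apply (D a) \<xi>) \<xi>"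
      unfolding \<eta>(2) by (simp add: blinfun.scaleR_right cinner_simps D(2))
  qed
qed

lemma linear_map_on_scaleR:
  assumes "linear_map_on M T" "x \<in> M"
  shows "T (t *\<^sub>R x) = t *\<^sub>R T x"
proof -
  have "t *\<^sub>R y = scaleC_op (of_real t) y" for y :: "'a \<Rightarrow>\<^sub>L 'a"
    by (rule blinfun_eqI) (simp add: blinfun.scaleR_left scaleR_scaleC)
  then show ?thesis
    using assms by (simp add: linear_map_on_def)
qed

lemma derivation_on_zero:
  assumes "von_neumann_algebra M" "derivation_on M D"
  shows "D 0 = 0" "D id_blinfun = 0"
proof -
  have id: "id_blinfun \<in> M" using von_neumann_algebra_closed(5) [OF assms(1)] .
  then show "D 0 = 0"
    using linear_map_on_scaleR [of M D id_blinfun 0] assms(2) by (simp add: derivation_on_def)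
  have "D (id_blinfun \<odot> id_blinfun) = D id_blinfun \<odot> id_blinfun + id_blinfun \<odot> D id_blinfun"
    using assms(2) id unfolding derivation_on_def by blast
  then show "D id_blinfun = 0" by simp
qed

lemma weak_star_local_derivation_id:
  assumes M: "von_neumann_algebra M" and T: "weak_star_local_derivation_on M T"
  shows "T id_blinfun = 0"
proof (rule polarization_zero)
  have id: "id_blinfun \<in> M" using von_neumann_algebra_closed(5) [OF M] .
  then show "T id_blinfun \<in> bounded_operators"
    using T von_neumann_algebra_mem(1) [OF M]
    by (auto simp: weak_star_local_derivation_on_def linear_map_on_def)
  show "cinner (blinfun_apply (T id_blinfun) \<xi>) \<xi> = 0" for \<xi>
    using weak_star_local_derivation_vector [OF M T id, of \<xi>] derivation_on_zero(2) [OF M]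
    by (metis blinfun.zero_left cinner_zero(1))
qed

lemma weak_star_local_derivation_local_map:
  assumes M: "von_neumann_algebra M" and T: "weak_star_local_derivation_on M T"
  shows "local_map M T"
proof
  have lin: "linear_map_on M T"
    using T by (simp add: weak_star_local_derivation_on_def)
  show "T (x + y) = T x + T y" if "x \<in> M" "y \<in> M" for x y
    using lin that by (simp add: linear_map_on_def)
  show "T (t *\<^sub>R x) = t *\<^sub>R T x" if "x \<in> M" for t x
    using lin that by (rule linear_map_on_scaleR)
  fix p x
  assume p: "projection p" "p \<in> M" and x: "x \<in> M" "x \<odot> p = 0" "p \<odot> x = 0"
  show "p \<odot> T x \<odot> p = 0"
  proof (rule polarization_zero)
    have "p \<odot> T x \<odot> p \<in> M"
      using lin x p by (intro von_neumann_algebra_closed [OF M]) (simp_all add: linear_map_on_def)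
    then show "p \<odot> T x \<odot> p \<in> bounded_operators"
      using von_neumann_algebra_mem(1) [OF M] by auto
    fix \<xi>
    \<comment> \<open>Compression by \<open>p\<close> moves the test to the vector
      \<open>p \<xi>\<close>. The derivation \<open>D\<close> depends on this vector, but p D(x) p =
      0 holds whichever one is chosen.\<close>
    define \<eta> where "\<eta> = blinfun_apply p \<xi>"
    obtain D where D: "derivation_on M D"
      "cinner (blinfun_apply (T x) \<eta>) \<eta> = cinner (blinfun_apply (D x) \<eta>) \<eta>"
      by (rule weak_star_local_derivation_vector [OF M T x(1)])
    have "D (x \<odot> p) = D x \<odot> p + x \<odot> D p"
      using D(1) x p unfolding derivation_on_def by blast
    then have "D x \<odot> p = - (x \<odot> D p)"
      using derivation_on_zero(1) [OF M D(1)] x(2) by (simp add: add_eq_0_iff)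
    then have "p \<odot> (D x \<odot> p) = 0"
      using x(3) by (simp add: compose_minus_right compose_left_zero)
    then have "blinfun_apply p (blinfun_apply (D x) \<eta>) = 0"
      unfolding \<eta>_def by (metis blinfun_apply_blinfun_compose blinfun.zero_left)
    then have "cinner (blinfun_apply (D x) \<eta>) \<eta> = 0"
      using p(1) unfolding \<eta>_def by (simp flip: self_adjointD)
    then show "cinner (blinfun_apply (p \<odot> T x \<odot> p) \<xi>) \<xi> = 0"
      using D(2) p(1) by (simp add: \<eta>_def self_adjointD)
  qed
qed (fact M)

section \<open>Adjoints, and the Jordan identity on the whole algebra\<close>

lemma is_adjoint_add: "is_adjoint a b \<Longrightarrow> is_adjoint c d \<Longrightarrow> is_adjoint (a + c) (b + d)"
  by (simp add: is_adjoint_def blinfun_simps cinner_simps)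

lemma is_adjoint_diff: "is_adjoint a b \<Longrightarrow> is_adjoint c d \<Longrightarrow> is_adjoint (a - c) (b - d)"
  by (simp add: is_adjoint_def blinfun_simps cinner_simps)

lemma is_adjoint_scaleR: "is_adjoint a b \<Longrightarrow> is_adjoint (t *\<^sub>R a) (t *\<^sub>R b)"
  by (simp add: is_adjoint_def blinfun_simps cinner_simps)

lemma is_adjoint_scaleC_op: "is_adjoint a b \<Longrightarrow> is_adjoint (scaleC_op c a) (scaleC_op (cnj c) b)"
  by (simp add: is_adjoint_def cinner_simps)

text \<open>Taking adjoints keeps the diagonal condition and reverses products; this is what later
  yields the right-hand version of \<open>off_diag\<close>.\<close>

lemma local_map_adjoint:
  assumes T: "local_map M T" and adj: "\<And>x. x \<in> M \<Longrightarrow> self_adjoint x \<Longrightarrow> is_adjoint (T x) (T' x)"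
  shows "local_map M T'"
proof -
  interpret T: local_map M T by fact
  show ?thesis
  proof
    fix x y assume xy: "x \<in> M" "self_adjoint x" "y \<in> M" "self_adjoint y"
    have "is_adjoint (T (x + y)) (T' (x + y))"
      using xy by (intro adj T.closed) simp_all
    moreover have "is_adjoint (T (x + y)) (T' x + T' y)"
      using xy by (simp add: T.add is_adjoint_add adj)
    ultimately show "T' (x + y) = T' x + T' y"
      by (rule is_adjoint_unique)
  next
    fix x t assume x: "x \<in> M" "self_adjoint x"
    have "is_adjoint (T (t *\<^sub>R x)) (T' (t *\<^sub>R x))"
      using x by (intro adj T.closed) simp_all
    moreover have "is_adjoint (T (t *\<^sub>R x)) (t *\<^sub>R T' x)"
      using x by (simp add: T.scale is_adjoint_scaleR adj)
    ultimately show "T' (t *\<^sub>R x) = t *\<^sub>R T' x"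
      by (rule is_adjoint_unique)
  next
    fix p x
    assume p: "projection p" "p \<in> M" and x: "x \<in> M" "self_adjoint x" "x \<odot> p = 0" "p \<odot> x = 0"
    have "is_adjoint (p \<odot> T x \<odot> p) (p \<odot> (T' x \<odot> p))"
      using p x by (intro is_adjoint_compose adj) (simp_all flip: self_adjoint_def)
    then have "is_adjoint 0 (p \<odot> T' x \<odot> p)"
      using T.local_diag [OF p x] by (simp add: compose_assoc)
    moreover have "is_adjoint 0 0"
      by (simp flip: self_adjoint_def)
    ultimately show "p \<odot> T' x \<odot> p = 0"
      by (rule is_adjoint_unique)
  qed (fact T.vn)
qed

lemma weak_star_local_derivation_square:
  assumes M: "von_neumann_algebra M" and T: "weak_star_local_derivation_on M T"
    and a: "a \<in> M" "self_adjoint a"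
  shows "T (a \<odot> a) = T a \<odot> a + a \<odot> T a"
proof -
  \<comment> \<open>Outside \<open>M\<close> the value is arbitrary; inside, self-adjointness of the
    algebra provides an adjoint of \<open>T x\<close>.\<close>
  define T' where "T' x = (SOME b. is_adjoint (T x) b)" for x
  have adj: "is_adjoint (T x) (T' x)" if "x \<in> M" for x
  proof -
    have "T x \<in> M"
      using T that by (simp add: weak_star_local_derivation_on_def linear_map_on_def)
    then have "\<exists>b. is_adjoint (T x) b"
      using M by (auto simp: von_neumann_algebra_def)
    then show ?thesis
      unfolding T'_def by (rule someI_ex)
  qed
  note loc = weak_star_local_derivation_local_map [OF M T]
  show ?thesis
    by (rule local_map_jordan [OF loc local_map_adjoint [OF loc adj] adj
          weak_star_local_derivation_id [OF M T] a])
qed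

lemma scaleC_op_compose:
  "scaleC_op c a \<odot> b = scaleC_op c (a \<odot> b)"
  "a \<in> bounded_operators \<Longrightarrow> a \<odot> scaleC_op c b = scaleC_op c (a \<odot> b)"
  by (rule blinfun_eqI, simp add: bounded_operators_def)+

lemma scaleC_op_add: "scaleC_op c (a + b) = scaleC_op c a + scaleC_op c b"
  by (rule blinfun_eqI) (simp add: blinfun.add_left scaleC_add_right)

lemma scaleC_op_i: "scaleC_op \<i> (scaleC_op \<i> a) = - a"
  by (rule blinfun_eqI) (simp add: scaleC_scaleC scaleC_minus1 blinfun.minus_left)

lemma von_neumann_algebra_cartesian:
  assumes M: "von_neumann_algebra M" and x: "x \<in> M"
  obtains a b where "a \<in> M" "self_adjoint a" "b \<in> M" "self_adjoint b" "x = a + scaleC_op \<i> b"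
proof -
  obtain y where y: "y \<in> M" "is_adjoint x y"
    using M x by (auto simp: von_neumann_algebra_def)
  note yx = is_adjoint_sym [OF y(2)]
  show thesis
  proof
    show "(1/2) *\<^sub>R (x + y) \<in> M" "scaleC_op (- \<i> / 2) (x - y) \<in> M"
      by (intro von_neumann_algebra_closed(1,2,4) [OF M] von_neumann_algebra_subalgebra(4) [OF M] x y)+
    have "is_adjoint ((1/2) *\<^sub>R (x + y)) ((1/2) *\<^sub>R (y + x))"
      by (intro is_adjoint_scaleR is_adjoint_add y yx)
    then show "self_adjoint ((1/2) *\<^sub>R (x + y))"
      by (simp add: self_adjoint_def add.commute)
    have "is_adjoint (scaleC_op (- \<i> / 2) (x - y)) (scaleC_op (cnj (- \<i> / 2)) (y - x))"
      by (intro is_adjoint_scaleC_op is_adjoint_diff y yx)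
    moreover have "scaleC_op (cnj (- \<i> / 2)) (y - x) = scaleC_op (- \<i> / 2) (x - y)"
    proof (rule blinfun_eqI)
      fix v
      have "(\<i> / 2) *\<^sub>C (blinfun_apply y v - blinfun_apply x v) =
          ((- \<i> / 2) * (-1)) *\<^sub>C (blinfun_apply y v - blinfun_apply x v)"
        by simp
      also have "\<dots> = (- \<i> / 2) *\<^sub>C ((-1) *\<^sub>C (blinfun_apply y v - blinfun_apply x v))"
        by (simp only: scaleC_scaleC)
      also have "(-1) *\<^sub>C (blinfun_apply y v - blinfun_apply x v) = blinfun_apply x v - blinfun_apply y v"
        by (simp only: scaleC_minus1 minus_diff_eq)
      finally show "blinfun_apply (scaleC_op (cnj (- \<i> / 2)) (y - x)) v =
          blinfun_apply (scaleC_op (- \<i> / 2) (x - y)) v"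
        by (simp add: blinfun.diff_left)
    qed
    ultimately show "self_adjoint (scaleC_op (- \<i> / 2) (x - y))"
      by (simp add: self_adjoint_def)
    show "x = (1/2) *\<^sub>R (x + y) + scaleC_op \<i> (scaleC_op (- \<i> / 2) (x - y))"
    proof (rule blinfun_eqI)
      fix v
      have "(1/2 :: complex) *\<^sub>C w = (1/2) *\<^sub>R w" for w :: 'a
        by (simp add: scaleR_scaleC)
      then show "blinfun_apply x v =
          blinfun_apply ((1/2) *\<^sub>R (x + y) + scaleC_op \<i> (scaleC_op (- \<i> / 2) (x - y))) v"
        by (simp add: blinfun_simps scaleC_scaleC scaleR_diff_right scaleR_add_right)
          (simp flip: scaleR_add_left)
    qed
  qed
qed

text \<open>Polarizing the identity at a + b gives the rule for a b + b a. Together with the squares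
  of \<open>a\<close> and \<open>b\<close> this determines \<open>T\<close> on the square of a +
  \<i> b.\<close>

lemma jordan_from_self_adjoint:
  assumes M: "von_neumann_algebra M" and lin: "linear_map_on M T"
    and square: "\<And>a. a \<in> M \<Longrightarrow> self_adjoint a \<Longrightarrow> T (a \<odot> a) = T a \<odot> a + a \<odot> T a"
    and x: "x \<in> M"
  shows "T (x \<odot> x) = T x \<odot> x + x \<odot> T x"
proof -
  obtain a b where a: "a \<in> M" "self_adjoint a" and b: "b \<in> M" "self_adjoint b"
    and xab: "x = a + scaleC_op \<i> b"
    by (rule von_neumann_algebra_cartesian [OF M x])
  note closed = von_neumann_algebra_closed [OF M]
  have Tadd: "T (u + v) = T u + T v" if "u \<in> M" "v \<in> M" for u v
    using lin that by (simp add: linear_map_on_def)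
  have TC: "T (scaleC_op c u) = scaleC_op c (T u)" if "u \<in> M" for c u
    using lin that by (simp add: linear_map_on_def)
  have Tdiff: "T (u - v) = T u - T v" if "u \<in> M" "v \<in> M" for u v
    using Tadd [of u "(-1) *\<^sub>R v"] linear_map_on_scaleR [OF lin that(2), of "-1"]
      closed(4) [OF that(2), of "-1"] that by simp
  have bdd: "u \<in> bounded_operators" if "u \<in> M" for u
    using that von_neumann_algebra_mem(1) [OF M] by auto
  have TM: "T u \<in> M" if "u \<in> M" for u
    using lin that by (simp add: linear_map_on_def)
  have ab: "a \<odot> b + b \<odot> a \<in> M" "a \<odot> a \<in> M" "b \<odot> b \<in> M"
    using a b by (auto intro: closed)
  have "(a + b) \<odot> (a + b) = a \<odot> a + (a \<odot> b + b \<odot> a) + b \<odot> b"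
    by (simp add: compose_simps)
  then have "T (a \<odot> a) + T (a \<odot> b + b \<odot> a) + T (b \<odot> b) = T ((a + b) \<odot> (a + b))"
    using ab closed by (simp add: Tadd)
  also have "\<dots> = T (a + b) \<odot> (a + b) + (a + b) \<odot> T (a + b)"
    using a b by (intro square closed) simp_all
  also have "\<dots> = T a \<odot> a + T a \<odot> b + T b \<odot> a + T b \<odot> b + (a \<odot> T a + a \<odot> T b + b \<odot> T a + b \<odot> T b)"
    using a b by (simp add: Tadd compose_simps)
  finally have cross: "T (a \<odot> b + b \<odot> a) = T a \<odot> b + a \<odot> T b + T b \<odot> a + b \<odot> T a"
    unfolding square [OF a] square [OF b] by (simp add: algebra_simps)
  have "x \<odot> x = a \<odot> a - b \<odot> b + scaleC_op \<i> (a \<odot> b + b \<odot> a)"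
    using a b bdd by (simp add: xab compose_simps scaleC_op_compose scaleC_op_add scaleC_op_i)
  then have "T (x \<odot> x) = T (a \<odot> a) - T (b \<odot> b) + scaleC_op \<i> (T (a \<odot> b + b \<odot> a))"
    using ab closed von_neumann_algebra_subalgebra(4) [OF M] by (simp add: Tadd Tdiff TC)
  also have "\<dots> = T x \<odot> x + x \<odot> T x"
    using a b bdd TM von_neumann_algebra_subalgebra(4) [OF M]
    by (simp add: cross square xab Tadd TC compose_simps scaleC_op_compose scaleC_op_add scaleC_op_i)
  finally show ?thesis .
qed

text \<open>Take for y the adjoint of x. Then x y x = 0 makes the squared norm of y x v vanish, and
  y x = 0 makes that of x v vanish.\<close>

lemma von_neumann_algebra_semiprime:
  assumes M: "von_neumann_algebra M" and x: "x \<in> M" "\<And>y. y \<in> M \<Longrightarrow> x \<odot> (y \<odot> x) = 0"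
  shows "x = 0"
proof (rule blinfun_eqI)
  fix v
  obtain y where y: "y \<in> M" "is_adjoint x y"
    using M x(1) by (auto simp: von_neumann_algebra_def)
  have "blinfun_apply x (blinfun_apply y (blinfun_apply x v)) = 0"
    using x(2) [OF y(1)] by (metis blinfun_apply_blinfun_compose blinfun.zero_left)
  then have "cinner (blinfun_apply y (blinfun_apply x v)) (blinfun_apply y (blinfun_apply x v)) = 0"
    using y(2) unfolding is_adjoint_def by (metis cinner_zero(1))
  then have "cinner (blinfun_apply x v) (blinfun_apply x v) = 0"
    using y(2) unfolding is_adjoint_def by (metis cinner_self_eq_0 cinner_zero(2))
  then show "blinfun_apply x v = blinfun_apply 0 v"
    by (simp add: cinner_self_eq_0)
qed

theorem theorem3p1:
  fixes M :: "('h :: complex_hilbert_space \<Rightarrow>\<^sub>L 'h) set"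
    and T :: "('h \<Rightarrow>\<^sub>L 'h) \<Rightarrow> ('h \<Rightarrow>\<^sub>L 'h)"
  assumes "von_neumann_algebra M"
    and "weak_star_local_derivation_on M T"
  shows "derivation_on M T"
proof -
  note M = assms(1) and T = assms(2)
  have lin: "linear_map_on M T"
    using T by (simp add: weak_star_local_derivation_on_def)
  interpret jordan_derivation_semiprime "(o\<^sub>L)" M T
  proof
    show "T (x \<odot> x) = T x \<odot> x + x \<odot> T x" if "x \<in> M" for x
      using jordan_from_self_adjoint [OF M lin weak_star_local_derivation_square [OF M T] that] .
    show "x = 0" if "x \<in> M" "\<And>y. y \<in> M \<Longrightarrow> x \<odot> (y \<odot> x) = 0" for x
      using von_neumann_algebra_semiprime [OF M that] .
  qed (use lin von_neumann_algebra_closed [OF M] in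
      \<open>auto simp: compose_simps linear_map_on_def\<close>)
  show ?thesis
    unfolding derivation_on_def using lin derivation by blast
qed

end
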